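(* Let $\boldsymbol F$ and $\boldsymbol G$ be continuously differentiable vector fields on the $N$-torus, let $T>0$, and let $K$ be an integrable function on $[0,T]$ with $K(t)\ge K_{\min}>0$ on $[0,T]$. Put $S(t)=\int_0^tK(u)\,\mathrm du$ and $S_T=S(T)$, and let $s\mapsto t(s)$ be the inverse of $S$ on $[0,S_T]$. Let $\boldsymbol\vartheta(s)$ be the solution of $\frac{\mathrm d\boldsymbol\vartheta}{\mathrm ds}=\boldsymbol F(\boldsymbol\vartheta)$, $\boldsymbol\vartheta(0)=\boldsymbol\theta_0$, and let $\boldsymbol\theta_\varepsilon$ be the solution on $[0,T]$ of $$\dot{\boldsymbol\theta}_\varepsilon=K(t)\boldsymbol F(\boldsymbol\theta_\varepsilon)+\varepsilon\,\boldsymbol G(\boldsymbol\theta_\varepsilon),\qquad \boldsymbol\theta_\varepsilon(0)=\boldsymbol\theta_0 .$$ Write $$\boldsymbol\theta_\varepsilon(t(s))=\boldsymbol\vartheta(s)+\varepsilon\,\boldsymbol\psi(s)+O(\varepsilon^2).$$ If $M(s,u)$ is the fundamental matrix generated by $A(s)=D\boldsymbol F(\boldsymbol\vartheta(s))$, then $$\boldsymbol\psi(S_T)=\int_0^{S_T}M(S_T,s)\,\boldsymbol G(\boldsymbol\vartheta(s))\,w(s)\,\mathrm ds,\qquad w(s)=\frac1{K(t(s))}.$$ At fixed physical duration $T$, $$\int_0^{S_T}w(s)\,\mathrm ds=T.$$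
   Context: The fundamental matrix $M(s,u)$ is the solution of $\partial_sM(s,u)=A(s)M(s,u)$ with $M(u,u)=I$. Vector fields on the $N$-torus are identified with vector fields on $\mathbb R^N$ that are $2\pi$-periodic in each coordinate, and solutions with their continuous lifts to $\mathbb R^N$, so that $\boldsymbol\psi(s)\in\mathbb R^N$. A solution means an absolutely continuous function satisfying the differential equation for almost every $t$. *)

theory Defs
  imports "HOL-Analysis.Analysis" "HOL-Library.Landau_Symbols"
begin

text \<open>
  Absolute continuity in the usual epsilon-delta form. The condition \<open>p division_of \<Union>p\<close> says
  exactly that \<open>p\<close> is a finite family of nonempty compact intervals with pairwise disjoint
  interiors; for such an interval \<open>k\<close>, \<open>Inf k\<close> and \<open>Sup k\<close> are its endpoints.
\<close>

definition abs_continuous_on :: "real set \<Rightarrow> (real \<Rightarrow> 'a::real_normed_vector) \<Rightarrow> bool" where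
  "abs_continuous_on I f \<longleftrightarrow>
     (\<forall>e>0. \<exists>d>0. \<forall>p. p division_of \<Union>p \<and> \<Union>p \<subseteq> I \<and> (\<Sum>k\<in>p. Sup k - Inf k) < d \<longrightarrow>
        (\<Sum>k\<in>p. norm (f (Sup k) - f (Inf k))) < e)"

text \<open>Solutions in the sense of Caratheodory; values outside \<open>{a..b}\<close> are irrelevant.\<close>

definition ode_solution ::
  "(real \<Rightarrow> 'a \<Rightarrow> 'a) \<Rightarrow> real \<Rightarrow> real \<Rightarrow> (real \<Rightarrow> 'a::real_normed_vector) \<Rightarrow> bool" where
  "ode_solution f a b x \<longleftrightarrow>
     abs_continuous_on {a..b} x \<and>
     (AE t\<in>{a..b} in lebesgue. (x has_vector_derivative f t (x t)) (at t within {a..b}))"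

text \<open>
  A continuously differentiable vector field on the torus, identified with a vector field on
  Euclidean space that is \<open>2 * pi\<close>-periodic in each coordinate.
\<close>

definition C1_torus_field :: "(real^'n \<Rightarrow> real^'n) \<Rightarrow> bool" where
  "C1_torus_field F \<longleftrightarrow>
     (\<forall>x i. F (x + axis i (2 * pi)) = F x) \<and>
     (\<forall>x. F differentiable (at x)) \<and>
     continuous_on UNIV (\<lambda>x. jacobian F (at x))"

definition fundamental_matrix ::
  "(real \<Rightarrow> real^'n^'n) \<Rightarrow> real \<Rightarrow> real \<Rightarrow> (real \<Rightarrow> real \<Rightarrow> real^'n^'n) \<Rightarrow> bool" where
  "fundamental_matrix A a b M \<longleftrightarrow>
     (\<forall>u\<in>{a..b}. ode_solution (\<lambda>s X. A s ** X) a b (\<lambda>s. M s u) \<and> M u u = mat 1)"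

end

theory Submission
  imports Defs
begin

text \<open>
  In the new time \<open>s\<close> the perturbed equation reads
  \<open>dz/ds = F(z) + \<epsilon> w(s) G(z)\<close>. With \<open>d = z - \<phi>\<close> and
  \<open>h = F(z) - F(\<phi>) + \<epsilon> w G(z)\<close>, variation of constants gives
  \<open>d(S\<^sub>T) = \<integral> M(S\<^sub>T,s) (h(s) - A(s) d(s)) ds\<close>; Gronwall's inequality gives
  \<open>d = O(\<epsilon>)\<close> uniformly in \<open>s\<close>, so that \<open>h - A d = \<epsilon> w G(\<phi>) + o(\<epsilon>)\<close>.
  Since \<open>K\<close> is only integrable, almost everywhere differentiability of \<open>S\<close> is avoided:
  all equations are used in integral form, and the change of time is made in the gauge integral.
\<close>

section \<open>Integral form of Caratheodory solutions\<close>

text \<open>The fields are only C^1, so the nonlinear remainder is controlled as o(\<epsilon>), by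
  uniform continuity of the Jacobian, and need not be O(\<epsilon>^2). The formal statement
  therefore asserts differentiability in \<epsilon> at 0 unconditionally, and identifies
  \<open>\<psi>\<close> by uniqueness of derivatives whenever the quadratic expansion holds. Two
  bounds carry the analysis. Periodicity and continuity make \<open>F\<close> and \<open>G\<close>
  globally bounded, so all trajectories with \<open>\<bar>\<epsilon>\<bar> \<le> 1\<close> stay in
  one ball with uniform constants; boundedness of \<open>h\<close> also makes \<open>d\<close>
  Lipschitz, which compensates for its missing pointwise derivative. The lower bound on
  \<open>K\<close> bounds the weight and makes the perturbed right-hand side at most a multiple of
  \<open>K\<close>, the domination under which Riemann sums survive the change of time. The
  definition of the fundamental matrix gives regularity in its first argument only; continuity in
  the second, over which the response integral runs, comes from the cocycle identity
  \<open>M r s ** M s u = M r u\<close>.\<close>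

lemma abs_continuous_on_subset:
  "abs_continuous_on I f \<Longrightarrow> J \<subseteq> I \<Longrightarrow> abs_continuous_on J f"
  unfolding abs_continuous_on_def by (meson subset_trans)

text \<open>
  The exceptional set gets an open cover of small measure as its gauge; absolute continuity then
  controls the increments of \<open>f\<close> over the tagged intervals lying in that cover.
\<close>

lemma has_integral_abs_continuous:
  fixes f :: "real \<Rightarrow> 'a::banach"
  assumes ab: "a \<le> b" and ac: "abs_continuous_on {a..b} f" and N: "negligible N"
    and deriv: "\<And>x. x \<in> {a..b} - N \<Longrightarrow> (f has_vector_derivative f' x) (at x within {a..b})"
  shows "(f' has_integral f b - f a) {a..b}"
proof -
  \<comment> \<open>Value 0 on the exceptional set: a tag in \<open>N\<close> contributes nothing to
    the Riemann sum, and only the increment of \<open>f\<close> over its interval remains to be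
    bounded.\<close>
  define g where "g x = (if x \<in> N then 0 else f' x)" for x
  have "(g has_integral f b - f a) {a..b}"
    unfolding has_integral_real
  proof (intro allI impI)
    fix e :: real assume e: "e > 0"
    \<comment> \<open>Tags outside \<open>N\<close> produce a total error of at most
      \<open>e1 * (b - a)\<close>; the summand 1 keeps the constant meaningful for
      \<open>a = b\<close>.\<close>
    define e1 where "e1 = e / (2 * (b - a + 1))"
    have e1: "e1 > 0" and e1b: "e1 * (b - a) < e / 2"
      using e ab by (auto simp: e1_def field_simps)
    have "\<forall>x. \<exists>d>0. x \<in> {a..b} - N \<longrightarrow>
         (\<forall>y\<in>{a..b}. norm (y-x) < d \<longrightarrow> norm (f y - f x - (y-x) *\<^sub>R g x) \<le> e1 * norm (y-x))"
      using deriv[unfolded has_vector_derivative_def has_derivative_within_alt] e1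
      unfolding g_def by (smt (verit) DiffD2 zero_less_one)
    then obtain d where dpos: "\<And>x. 0 < d x"
      and d: "\<And>x y. \<lbrakk>x \<in> {a..b} - N; y \<in> {a..b}; norm (y-x) < d x\<rbrakk>
                        \<Longrightarrow> norm (f y - f x - (y-x) *\<^sub>R g x) \<le> e1 * norm (y-x)"
      by metis
    obtain \<delta> where \<delta>: "\<delta> > 0" and ac\<delta>:
      "\<And>p. p division_of \<Union>p \<Longrightarrow> \<Union>p \<subseteq> {a..b} \<Longrightarrow> (\<Sum>k\<in>p. Sup k - Inf k) < \<delta> \<Longrightarrow>
        (\<Sum>k\<in>p. norm (f (Sup k) - f (Inf k))) < e/2"
      using ac e unfolding abs_continuous_on_def by (meson half_gt_zero)
    obtain U where U: "open U" "N \<subseteq> U" "U - N \<in> lmeasurable" "emeasure lebesgue (U - N) < ennreal \<delta>"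
      using sets_lebesgue_outer_open[OF negligible_imp_sets[OF N] \<delta>] .
    have UN: "U = (U - N) \<union> N" using U(2) by blast
    have Um: "U \<in> lmeasurable"
      using UN U(3) negligible_imp_measurable[OF N] fmeasurable.Un by metis
    have "measure lebesgue U \<le> measure lebesgue (U - N) + measure lebesgue N"
      using UN U(3) negligible_imp_sets[OF N] measure_Un_le by (metis fmeasurableD)
    moreover have "measure lebesgue (U - N) < \<delta>"
      using U(3,4) \<delta> by (simp add: emeasure_eq_measure2 ennreal_less_iff)
    ultimately have Ulen: "measure lebesgue U < \<delta>"
      using negligible_imp_measure0[OF N] by simp
    define \<gamma> where "\<gamma> x = (if x \<in> N then U else ball x (d x))" for x
    have gauge: "gauge \<gamma>"
      using U dpos by (auto simp: gauge_def \<gamma>_def)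
    have fine_bound: "norm ((\<Sum>(x,k)\<in>p. measure lborel k *\<^sub>R g x) - (f b - f a)) < e"
      if p: "p tagged_division_of {a..b}" and fine: "\<gamma> fine p" for p
    proof -
      let ?t = "\<lambda>(x,k). if x \<in> N then norm (f (Sup k) - f (Inf k)) else 0"
      have fp: "finite p" using p by auto
      have ba: "b - a = (\<Sum>(x,K)\<in>p. Sup K - Inf K)" "f b - f a = (\<Sum>(x,K)\<in>p. f(Sup K) - f(Inf K))"
        using additive_tagged_division_1[where f= "\<lambda>x. x"] additive_tagged_division_1[where f= f]
          ab p by auto
      have bound: "norm (measure lborel K *\<^sub>R g x - (f (Sup K) - f (Inf K))) \<le> e1 * (Sup K - Inf K) + ?t (x, K)"
        if xK: "(x, K) \<in> p" for x K
      proof -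
        obtain u v where k: "K = {u..v}" "x \<in> K" "K \<subseteq> {a..b}"
          using p xK by (metis box_real(2) tagged_division_ofD(2-4))
        have uv: "u \<le> v" "measure lborel K = v - u" using k by auto
        have sub: "K \<subseteq> \<gamma> x" using fine xK by (auto simp: fine_def)
        show ?thesis
        proof (cases "x \<in> N")
          case True then show ?thesis using e1 uv k by (auto simp: g_def norm_minus_commute)
        next
          case False
          have "u \<in> ball x (d x)" "v \<in> ball x (d x)"
            using k uv sub False by (auto simp: \<gamma>_def simp del: mem_ball)
          then have xx: "x \<in> {a..b} - N" and uu: "u \<in> {a..b}" "v \<in> {a..b}" "norm (u - x) < d x" "norm (v - x) < d x"
            using k uv False by (auto simp: dist_norm norm_minus_commute)
          \<comment> \<open>Straddling: because the tag lies between \<open>u\<close> and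
            \<open>v\<close>, the errors at the two endpoints add up to a multiple of
            \<open>v - u\<close>.\<close>
          have "norm ((v - u) *\<^sub>R g x - (f v - f u)) = norm (f u - f x - (u - x) *\<^sub>R g x - (f v - f x - (v - x) *\<^sub>R g x))"
            by (auto simp: algebra_simps)
          also have "\<dots> \<le> norm (f u - f x - (u - x) *\<^sub>R g x) + norm (f v - f x - (v - x) *\<^sub>R g x)"
            by (rule norm_triangle_ineq4)
          also have "\<dots> \<le> e1 * norm (u - x) + e1 * norm (v - x)"
            using d[OF xx uu(1,3)] d[OF xx uu(2,4)] by linarith
          also have "\<dots> = e1 * (v - u)"
            using k by (auto simp: algebra_simps)
          finally show ?thesis using False uv k by simp
        qed
      qed
      have "(\<Sum>(x,k)\<in>p. measure lborel k *\<^sub>R g x) - (f b - f a) =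
            (\<Sum>(x,k)\<in>p. measure lborel k *\<^sub>R g x - (f (Sup k) - f (Inf k)))"
        unfolding ba(2) by (simp add: sum_subtractf split_def)
      also have "norm \<dots> \<le> (\<Sum>xk\<in>p. e1 * (case xk of (x,k) \<Rightarrow> Sup k - Inf k) + ?t xk)"
      proof (rule sum_norm_le)
        fix xk assume xk: "xk \<in> p"
        obtain x k where "xk = (x, k)" by fastforce
        then show "norm (case xk of (x,k) \<Rightarrow> measure lborel k *\<^sub>R g x - (f (Sup k) - f (Inf k)))
            \<le> e1 * (case xk of (x,k) \<Rightarrow> Sup k - Inf k) + ?t xk"
          using bound[of x k] xk by (simp only: prod.case)
      qed
      also have "\<dots> = e1 * (b - a) + sum ?t p"
        unfolding ba(1) by (simp add: sum.distrib sum_distrib_left)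
      finally have le: "norm ((\<Sum>(x,k)\<in>p. measure lborel k *\<^sub>R g x) - (f b - f a)) \<le> e1 * (b - a) + sum ?t p" .
      have "sum ?t p < e/2"
      proof -
        define q where "q = {xk \<in> p. fst xk \<in> N}"
        have qp: "q tagged_partial_division_of {a..b}"
          by (rule tagged_partial_division_subset[of p]) (use p q_def in \<open>auto simp: tagged_division_of_def\<close>)
        have q: "q tagged_division_of \<Union>(snd ` q)"
          by (rule tagged_partial_division_of_Union_self[OF qp])
        have qd: "(snd ` q) division_of \<Union>(snd ` q)"
          by (rule division_of_tagged_division[OF q])
        have sub: "\<Union>(snd ` q) \<subseteq> {a..b}" "\<Union>(snd ` q) \<subseteq> U"
          using qp fine by (fastforce simp: q_def fine_def \<gamma>_def dest: tagged_partial_division_ofD(3))+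
        have meas: "\<Union>(snd ` q) \<in> lmeasurable"
          using lmeasurable_division[OF qd] .
        have "(\<Sum>k\<in>snd ` q. Sup k - Inf k) = (\<Sum>k\<in>snd ` q. measure lebesgue k)"
        proof (rule sum.cong[OF refl])
          fix k assume "k \<in> snd ` q"
          then obtain u v where "k = {u..v}" "u \<le> v"
            using division_ofD(3,4)[OF qd] by (metis atLeastatMost_empty_iff2 box_real(2))
          then show "Sup k - Inf k = measure lebesgue k" by simp
        qed
        also have "\<dots> = measure lebesgue (\<Union>(snd ` q))"
          by (rule content_division[OF qd])
        also have "\<dots> \<le> measure lebesgue U"
          using sub meas Um by (intro measure_mono_fmeasurable) auto
        finally have len: "(\<Sum>k\<in>snd ` q. Sup k - Inf k) < \<delta>" using Ulen by linarith
        have qN: "x \<in> N \<and> k \<noteq> {}" if "(x,k) \<in> q" for x k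
        proof
          show "x \<in> N" using that by (simp add: q_def)
          show "k \<noteq> {}" using tagged_division_ofD(2)[OF q that] by blast
        qed
        have "sum ?t p = sum ?t q"
        proof (rule sum.mono_neutral_right[OF fp])
          show "\<forall>xk\<in>p - q. ?t xk = 0" by (simp add: q_def split_beta)
        qed (simp add: q_def)
        \<comment> \<open>Passing from tagged intervals to the intervals themselves may merge
          degenerate ones that carry different tags, so the summand must vanish on every degenerate
          interval. The guard forces this for \<open>{}\<close>, whose \<open>Sup\<close> and
          \<open>Inf\<close> are unspecified.\<close>
        also have "\<dots> = (\<Sum>(x,k)\<in>q. if k = {} then 0 else norm (f (Sup k) - f (Inf k)))"
        proof (rule sum.cong[OF refl])
          fix xk assume xk: "xk \<in> q"
          obtain x k where [simp]: "xk = (x, k)" by fastforce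
          show "?t xk =
              (case xk of (x, k) \<Rightarrow> if k = {} then 0 else norm (f (Sup k) - f (Inf k)))"
            using qN[of x k] xk by simp
        qed
        also have "\<dots> = (\<Sum>k\<in>snd ` q. if k = {} then 0 else norm (f (Sup k) - f (Inf k)))"
        proof (rule sum.over_tagged_division_lemma[OF q])
          fix u v :: real assume "box u v = {}"
          then have "u = v \<or> cbox u v = {}" by auto
          then show "(if cbox u v = {} then 0 else norm (f (Sup (cbox u v)) - f (Inf (cbox u v)))) = 0"
            by auto
        qed
        also have "\<dots> = (\<Sum>k\<in>snd ` q. norm (f (Sup k) - f (Inf k)))"
          using division_ofD(3)[OF qd] by (intro sum.cong) auto
        also have "\<dots> < e/2" by (rule ac\<delta>[OF qd sub(1) len])
        finally show ?thesis .
      qed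
      then show ?thesis using le e1b by linarith
    qed
    show "\<exists>\<gamma>. gauge \<gamma> \<and> (\<forall>\<D>. \<D> tagged_division_of {a..b} \<and> \<gamma> fine \<D> \<longrightarrow>
        norm ((\<Sum>(x,k)\<in>\<D>. measure lborel k *\<^sub>R g x) - (f b - f a)) < e)"
      by (intro exI[of _ "\<gamma>"] conjI gauge allI impI, elim conjE, rule fine_bound)
  qed
  then show ?thesis
    by (rule has_integral_spike[OF N, rotated]) (auto simp: g_def)
qed

text \<open>All later use of Caratheodory solutions passes through this integral equation. Absolute
  continuity and derivatives within the interval survive restriction to \<open>{a..c}\<close>, so
  every upper limit is available.\<close>

lemma ode_solution_has_integral:
  fixes x :: "real \<Rightarrow> 'a::banach"
  assumes x: "ode_solution f a b x" and c: "c \<in> {a..b}"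
  shows "((\<lambda>t. f t (x t)) has_integral x c - x a) {a..c}"
proof -
  obtain N where N: "negligible N"
    and d: "\<And>t. t \<in> {a..b} - N \<Longrightarrow> (x has_vector_derivative f t (x t)) (at t within {a..b})"
  proof -
    have "AE t in lebesgue. t \<in> {a..b} \<longrightarrow> (x has_vector_derivative f t (x t)) (at t within {a..b})"
      using x unfolding ode_solution_def by simp
    then obtain N where "N \<in> null_sets lebesgue"
      "\<And>t. t \<notin> N \<Longrightarrow> t \<in> {a..b} \<longrightarrow> (x has_vector_derivative f t (x t)) (at t within {a..b})"
      by (rule AE_E3) auto
    then show ?thesis
      by (intro that[of N]) (auto simp: negligible_iff_null_sets)
  qed
  show ?thesis
  proof (rule has_integral_abs_continuous[OF _ _ N])
    show "abs_continuous_on {a..c} x"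
      using x c by (auto simp: ode_solution_def intro: abs_continuous_on_subset)
    fix t assume "t \<in> {a..c} - N"
    then show "(x has_vector_derivative f t (x t)) (at t within {a..c})"
      using d[of t] c by (auto intro: has_vector_derivative_within_subset)
  qed (use c in auto)
qed

section \<open>Change of time\<close>

locale time_change =
  fixes K :: "real \<Rightarrow> real" and T m :: real
  assumes T: "0 \<le> T" and K_int: "K integrable_on {0..T}" and m: "0 < m"
    and K_ge: "\<And>u. u \<in> {0..T} \<Longrightarrow> m \<le> K u"
begin

definition S :: "real \<Rightarrow> real" where "S r = integral {0..r} K"
definition t :: "real \<Rightarrow> real" where "t = the_inv_into {0..T} S"

section \<open>The time map \<open>S\<close> and its Lipschitz inverse\<close>

lemma S_0 [simp]: "S 0 = 0"
  by (simp add: S_def)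

lemma K_integrable: "0 \<le> u \<Longrightarrow> v \<le> T \<Longrightarrow> K integrable_on {u..v}"
  using integrable_on_subinterval[OF K_int] by auto

lemma S_diff:
  assumes "0 \<le> u" "u \<le> v" "v \<le> T"
  shows "S v - S u = integral {u..v} K"
  using Henstock_Kurzweil_Integration.integral_combine[of 0 u v K] assms K_integrable[of 0 v]
  by (simp add: S_def)

text \<open>Integrating \<open>K \<ge> m\<close> gives an expansion rate for \<open>S\<close>;
  strict monotonicity of \<open>S\<close> and the Lipschitz constant \<open>1 / m\<close> of
  \<open>t\<close> both come from it.\<close>

lemma S_diff_ge:
  assumes "0 \<le> u" "u \<le> v" "v \<le> T"
  shows "m * (v - u) \<le> S v - S u"
proof -
  have "integral {u..v} (\<lambda>_. m) \<le> integral {u..v} K"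
    using assms K_ge by (intro integral_le K_integrable) auto
  then show ?thesis using S_diff assms by (simp add: mult.commute)
qed

lemma S_less_iff:
  assumes "u \<in> {0..T}" "v \<in> {0..T}"
  shows "S u < S v \<longleftrightarrow> u < v"
proof -
  have *: "S x < S y" if "x \<in> {0..T}" "y \<in> {0..T}" "x < y" for x y
  proof -
    have "0 < m * (y - x)" using that m by simp
    then show ?thesis using S_diff_ge[of x y] that by simp
  qed
  consider "u < v" | "u = v" | "v < u" by linarith
  then show ?thesis using *[OF assms] *[OF assms(2,1)] by cases simp_all
qed

lemma S_le_iff:
  assumes "u \<in> {0..T}" "v \<in> {0..T}"
  shows "S u \<le> S v \<longleftrightarrow> u \<le> v"
  using S_less_iff[OF assms(2,1)] by linarith

lemma S_inj: "inj_on S {0..T}"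
  by (intro inj_onI) (metis S_le_iff antisym order_refl)

lemma S_continuous: "continuous_on {0..T} S"
  unfolding S_def by (rule indefinite_integral_continuous_1[OF K_int])

lemma S_image:
  assumes "c \<in> {0..T}"
  shows "S ` {0..c} = {0..S c}"
proof
  show "S ` {0..c} \<subseteq> {0..S c}"
    using S_le_iff[of 0] S_le_iff[of _ c] assms T by auto
  show "{0..S c} \<subseteq> S ` {0..c}"
  proof
    fix y assume "y \<in> {0..S c}"
    then show "y \<in> S ` {0..c}"
      using IVT'[of S 0 y c] assms continuous_on_subset[OF S_continuous, of "{0..c}"]
      by (force simp: S_0)
  qed
qed

lemma t_S [simp]: "u \<in> {0..T} \<Longrightarrow> t (S u) = u"
  unfolding t_def by (rule the_inv_into_f_f[OF S_inj])

lemma S_t [simp]: "s \<in> {0..S T} \<Longrightarrow> S (t s) = s"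
  unfolding t_def using S_image[of T] T by (intro f_the_inv_into_f[OF S_inj]) auto

lemma t_in: "s \<in> {0..S T} \<Longrightarrow> t s \<in> {0..T}"
proof -
  assume "s \<in> {0..S T}"
  then have "s \<in> S ` {0..T}" using S_image[of T] T by simp
  then obtain u where "u \<in> {0..T}" "s = S u" by blast
  then show ?thesis using t_S by metis
qed

lemma S_in: "u \<in> {0..T} \<Longrightarrow> S u \<in> {0..S T}"
  using S_image[of T] T by force

lemma t_le_iff:
  assumes "r \<in> {0..S T}" "s \<in> {0..S T}"
  shows "t r \<le> t s \<longleftrightarrow> r \<le> s"
  using S_le_iff[OF t_in[OF assms(1)] t_in[OF assms(2)]] unfolding S_t[OF assms(1)] S_t[OF assms(2)] by (rule sym)

lemma t_0 [simp]: "t 0 = 0"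
  using t_S[of 0] T by simp

lemma t_Lipschitz:
  assumes "r \<in> {0..S T}" "s \<in> {0..S T}"
  shows "\<bar>t r - t s\<bar> \<le> \<bar>r - s\<bar> / m"
proof -
  have *: "\<bar>t r - t s\<bar> \<le> \<bar>r - s\<bar> / m" if "r \<in> {0..S T}" "s \<in> {0..S T}" "r \<le> s" for r s
    using S_diff_ge[of "t r" "t s"] t_le_iff[of r s] t_in[of r] t_in[of s] that m
    by (simp add: field_simps)
  show ?thesis
    using *[OF assms] *[OF assms(2,1)] by (cases "r \<le> s") (auto simp: abs_minus_commute)
qed

lemma t_continuous: "continuous_on {0..S T} t"
proof (rule continuous_onI)
  fix s e :: real assume s: "s \<in> {0..S T}" and e: "0 < e"
  have "dist (t r) (t s) \<le> e" if "r \<in> {0..S T}" "dist r s < e * m" for r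
  proof -
    have "\<bar>r - s\<bar> / m \<le> e" using that(2) m by (simp add: dist_real_def pos_divide_le_eq)
    then show ?thesis using t_Lipschitz[OF that(1) s] by (simp add: dist_real_def)
  qed
  then show "\<exists>d>0. \<forall>r\<in>{0..S T}. dist r s < d \<longrightarrow> dist (t r) (t s) \<le> e"
    using e m by (intro exI[of _ "e * m"]) auto
qed

lemma t_image:
  assumes "r \<in> {0..S T}" "s \<in> {0..S T}" "r \<le> s"
  shows "t ` {r..s} = {t r..t s}"
proof
  show "t ` {r..s} \<subseteq> {t r..t s}"
    using assms by (auto simp: t_le_iff)
  show "{t r..t s} \<subseteq> t ` {r..s}"
  proof
    fix u assume u: "u \<in> {t r..t s}"
    then have "u \<in> {0..T}" using t_in[OF assms(1)] t_in[OF assms(2)] by auto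
    then show "u \<in> t ` {r..s}"
      using u S_le_iff[of "t r" u] S_le_iff[of u "t s"] t_in assms
      by (intro image_eqI[of _ _ "S u"]) auto
  qed
qed

text \<open>The inverse time map is an increasing homeomorphism, hence maps intervals to intervals
  and preserves non-overlap. Injectivity on \<open>p\<close> is recorded because the Riemann sums
  over the two divisions are compared by reindexing.\<close>

lemma tagged_division_image:
  assumes c: "c \<in> {0..T}" and p: "p tagged_division_of {0..S c}"
  shows "(\<lambda>(s,J). (t s, t ` J)) ` p tagged_division_of {0..c}"
    and "inj_on (\<lambda>(s,J). (t s, t ` J)) p"
proof -
  have sub: "{0..S c} \<subseteq> {0..S T}" using S_in[OF c] by auto
  have J: "\<exists>a b. J = {a..b} \<and> a \<le> s \<and> s \<le> b \<and> a \<in> {0..S T} \<and> b \<in> {0..S T}" if sJ: "(s,J) \<in> p" for s J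
  proof -
    obtain a b where ab: "J = {a..b}" using tagged_division_ofD(4)[OF p sJ] by auto
    with tagged_division_ofD(2,3)[OF p sJ] sub show ?thesis
      by (intro exI[of _ a] exI[of _ b]) (auto simp: subset_eq)
  qed
  have injt: "inj_on t {0..S T}"
    by (intro inj_onI) (metis S_t)
  show "inj_on (\<lambda>(s,J). (t s, t ` J)) p"
  proof (rule inj_onI, clarify)
    fix s J r I assume *: "(s,J) \<in> p" "(r,I) \<in> p" "t s = t r" "t ` J = t ` I"
    have "J \<subseteq> {0..S T}" "I \<subseteq> {0..S T}" "s \<in> {0..S T}" "r \<in> {0..S T}"
      using J[OF *(1)] J[OF *(2)] by auto
    then show "s = r \<and> J = I"
      using * injt inj_on_image_eq_iff[OF injt] by (metis inj_onD)
  qed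
  show "(\<lambda>(s,J). (t s, t ` J)) ` p tagged_division_of {0..c}"
  proof (rule tagged_division_ofI)
    show "finite ((\<lambda>(s,J). (t s, t ` J)) ` p)" using p by auto
  next
    fix x I assume "(x, I) \<in> (\<lambda>(s,J). (t s, t ` J)) ` p"
    then obtain s J where sJ: "(s,J) \<in> p" "x = t s" "I = t ` J" by auto
    obtain a b where ab: "J = {a..b}" "a \<le> s" "s \<le> b" "a \<in> {0..S T}" "b \<in> {0..S T}"
      using J[OF sJ(1)] by auto
    show "x \<in> I" using sJ ab by auto
    have "b \<le> S c" using tagged_division_ofD(3)[OF p sJ(1)] ab by auto
    then have "t b \<le> c"
      using t_le_iff[of b "S c"] ab S_in[OF c] c by simp
    then show "I \<subseteq> {0..c}" using t_in[OF ab(4)] ab sJ t_image[of a b] by auto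
    show "\<exists>a b. I = cbox a b" using ab sJ t_image[of a b] by auto
  next
    fix x I x' I'
    assume 1: "(x, I) \<in> (\<lambda>(s,J). (t s, t ` J)) ` p" and 2: "(x', I') \<in> (\<lambda>(s,J). (t s, t ` J)) ` p"
      and ne: "(x, I) \<noteq> (x', I')"
    obtain s J where sJ: "(s,J) \<in> p" "x = t s" "I = t ` J" using 1 by auto
    obtain r H where rH: "(r,H) \<in> p" "x' = t r" "I' = t ` H" using 2 by auto
    obtain a b where ab: "J = {a..b}" "a \<le> s" "s \<le> b" "a \<in> {0..S T}" "b \<in> {0..S T}"
      using J[OF sJ(1)] by auto
    obtain a' b' where ab': "H = {a'..b'}" "a' \<le> r" "r \<le> b'" "a' \<in> {0..S T}" "b' \<in> {0..S T}"
      using J[OF rH(1)] by auto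
    have disj: "interior J \<inter> interior H = {}"
      using tagged_division_ofD(5)[OF p sJ(1) rH(1)] ne sJ rH by auto
    \<comment> \<open>A common interior point \<open>u\<close> of the images would return, through
      the strictly increasing \<open>S\<close>, to a common interior point of \<open>J\<close> and
      \<open>H\<close>.\<close>
    show "interior I \<inter> interior I' = {}"
    proof (rule ccontr)
      assume "interior I \<inter> interior I' \<noteq> {}"
      then obtain u where u: "t a < u" "u < t b" "t a' < u" "u < t b'"
        using sJ rH ab ab' t_image[of a b] t_image[of a' b']
        by (auto simp: ex_in_conv[symmetric] simp del: ex_in_conv greaterThanLessThan_empty_iff Int_greaterThanLessThan)
      then have uT: "u \<in> {0..T}" using t_in[OF ab(4)] t_in[OF ab(5)] by auto
      have "S u \<in> interior J \<inter> interior H"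
        using u S_less_iff[OF t_in[OF ab(4)] uT] S_less_iff[OF uT t_in[OF ab(5)]]
          S_less_iff[OF t_in[OF ab'(4)] uT] S_less_iff[OF uT t_in[OF ab'(5)]] ab ab' by simp
      then show False using disj by auto
    qed
  next
    have "{I. \<exists>x. (x, I) \<in> (\<lambda>(s,J). (t s, t ` J)) ` p} = (`) t ` {J. \<exists>s. (s,J) \<in> p}"
      by (auto intro: rev_image_eqI)
    then have "\<Union> {I. \<exists>x. (x, I) \<in> (\<lambda>(s,J). (t s, t ` J)) ` p} = t ` \<Union>{J. \<exists>s. (s,J) \<in> p}"
      by (simp add: image_Union)
    also have "\<dots> = t ` {0..S c}"
      using tagged_division_ofD(6)[OF p] by simp
    also have "\<dots> = {0..c}"
      using t_image[of 0 "S c"] S_in[OF c] c by auto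
    finally show "\<Union> {I. \<exists>x. (x, I) \<in> (\<lambda>(s,J). (t s, t ` J)) ` p} = {0..c}" .
  qed
qed

text \<open>
  Tagged divisions are transported by \<open>t\<close>. The bound on \<open>f\<close> keeps \<open>norm (f u) / K u\<close> bounded,
  so the error is dominated by the sum that the Henstock lemma makes small for \<open>K\<close>.
\<close>

lemma has_integral_time_change:
  fixes f :: "real \<Rightarrow> 'a::banach"
  assumes c: "c \<in> {0..T}" and f: "(f has_integral I) {0..c}"
    and B: "\<And>u. u \<in> {0..c} \<Longrightarrow> norm (f u) \<le> B * K u"
  shows "((\<lambda>s. (1 / K (t s)) *\<^sub>R f (t s)) has_integral I) {0..S c}"
  unfolding has_integral_real
proof (intro allI impI)
  fix e :: real assume e: "e > 0"
  have B0: "0 \<le> B"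
    using B[of 0] K_ge[of 0] m c by (smt (verit) atLeastAtMost_iff norm_ge_zero zero_le_mult_iff)
  obtain \<gamma>1 where \<gamma>1: "gauge \<gamma>1" and f1:
    "\<And>p. p tagged_division_of {0..c} \<Longrightarrow> \<gamma>1 fine p \<Longrightarrow>
       norm ((\<Sum>(x,k)\<in>p. measure lborel k *\<^sub>R f x) - I) < e/2"
    using f e unfolding has_integral_real by (meson half_gt_zero)
  \<comment> \<open>The Henstock error for \<open>K\<close> gets multiplied by \<open>B\<close>;
    dividing by \<open>B + 1\<close> leaves at most \<open>e / 2\<close>, also for
    \<open>B = 0\<close>.\<close>
  have e2: "e / (2 * (B + 1)) > 0" using e B0 by simp
  obtain \<gamma>2 where \<gamma>2: "gauge \<gamma>2" and K2:
    "\<And>p. p tagged_partial_division_of {0..c} \<Longrightarrow> \<gamma>2 fine p \<Longrightarrow>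
       (\<Sum>(x,k)\<in>p. norm (measure lborel k *\<^sub>R K x - integral k K)) < e / (2 * (B + 1))"
    using Henstock_lemma[of K 0 c, OF _ e2] K_integrable[of 0 c] c by auto
  define \<gamma> where "\<gamma> x = \<gamma>1 x \<inter> \<gamma>2 x" for x
  have \<gamma>: "gauge \<gamma>" unfolding \<gamma>_def by (rule gauge_Int[OF \<gamma>1 \<gamma>2])
  \<comment> \<open>A gauge must assign an open set to every real point, so \<open>t\<close> is
    first extended continuously by constants beyond \<open>{0..S T}\<close>.\<close>
  define tc where "tc s = t (max 0 (min (S T) s))" for s
  have tc: "tc s = t s" if "s \<in> {0..S T}" for s using that by (simp add: tc_def)
  have ST0: "0 \<le> S T" using S_in[of 0] T by auto
  have tc_cont: "continuous_on UNIV tc"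
    unfolding tc_def using ST0
    by (intro continuous_on_compose2[OF t_continuous] continuous_intros) auto
  define \<gamma>' where "\<gamma>' s = tc -` \<gamma> (tc s)" for s
  have gauge: "gauge \<gamma>'"
    unfolding gauge_def \<gamma>'_def
    using \<gamma> open_vimage[OF _ tc_cont] by (simp add: gauge_def)
  have fine_bound: "norm ((\<Sum>(s,k)\<in>p. measure lborel k *\<^sub>R ((1 / K (t s)) *\<^sub>R f (t s))) - I) < e"
    if p: "p tagged_division_of {0..S c}" and fine: "\<gamma>' fine p" for p
  proof -
    let ?h = "\<lambda>(s,J). (t s, t ` J)"
    let ?q = "?h ` p"
    have q: "?q tagged_division_of {0..c}" and inj: "inj_on ?h p"
      using tagged_division_image[OF c p] by auto
    have Sc: "S c \<in> {0..S T}" using S_in[OF c] .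
    have J: "\<exists>a b. J = {a..b} \<and> a \<le> s \<and> s \<le> b \<and> a \<in> {0..S c} \<and> b \<in> {0..S c}" if sJ: "(s,J) \<in> p" for s J
    proof -
      obtain a b where ab: "J = {a..b}" using tagged_division_ofD(4)[OF p sJ] by auto
      with tagged_division_ofD(2,3)[OF p sJ] show ?thesis
        by (intro exI[of _ a] exI[of _ b]) (auto simp: subset_eq)
    qed
    have "\<gamma> fine ?q"
      unfolding fine_def
    proof clarify
      fix s J r assume *: "(s,J) \<in> p" "r \<in> J"
      then have "r \<in> {0..S T}" "s \<in> {0..S T}" using J[OF *(1)] Sc by auto
      then show "t r \<in> \<gamma> (t s)"
        using fineD[OF fine *(1)] *(2) tc[of r] tc[of s] unfolding \<gamma>'_def by auto
    qed
    then have fine: "\<gamma>1 fine ?q" "\<gamma>2 fine ?q" unfolding fine_def \<gamma>_def by blast+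
    have tag_bound: "norm (measure lborel J *\<^sub>R ((1 / K (t s)) *\<^sub>R f (t s)) - measure lborel (t ` J) *\<^sub>R f (t s))
        \<le> B * norm (measure lborel (t ` J) *\<^sub>R K (t s) - integral (t ` J) K)"
      if sJ: "(s,J) \<in> p" for s J
    proof -
      obtain a b where ab: "J = {a..b}" "a \<le> s" "s \<le> b" "a \<in> {0..S c}" "b \<in> {0..S c}"
        using J[OF sJ] by auto
      have mem: "a \<in> {0..S T}" "b \<in> {0..S T}" "s \<in> {0..S T}" using ab Sc by auto
      have tJ: "t ` J = {t a..t b}" using ab mem t_image by auto
      have tab: "t a \<le> t b" using mem ab t_le_iff by auto
      \<comment> \<open>The length of \<open>J\<close> in the new time is exactly the integral of
        \<open>K\<close> over the image interval, so the two Riemann terms differ by a Henstock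
        error of \<open>K\<close> times the value of \<open>f / K\<close> at the tag.\<close>
      have lenJ: "measure lborel J = integral (t ` J) K"
        using S_diff[of "t a" "t b"] t_in[OF mem(1)] t_in[OF mem(2)] tab mem ab tJ by simp
      have "t s \<le> c" using t_le_iff[OF mem(3) Sc] ab c by simp
      then have ts: "t s \<in> {0..c}" using t_in[OF mem(3)] by simp
      have Kpos: "0 < K (t s)" using K_ge[of "t s"] m ts c by auto
      have eq: "measure lborel J *\<^sub>R ((1 / K (t s)) *\<^sub>R f (t s)) - measure lborel (t ` J) *\<^sub>R f (t s)
        = ((integral (t ` J) K - measure lborel (t ` J) * K (t s)) / K (t s)) *\<^sub>R f (t s)"
        unfolding lenJ using Kpos by (simp add: diff_divide_distrib scaleR_diff_left)
      have "norm (((integral (t ` J) K - measure lborel (t ` J) * K (t s)) / K (t s)) *\<^sub>R f (t s))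
        = \<bar>measure lborel (t ` J) * K (t s) - integral (t ` J) K\<bar> * (norm (f (t s)) / K (t s))"
        using Kpos unfolding norm_scaleR abs_divide
        by (simp only: abs_of_pos times_divide_eq_right times_divide_eq_left abs_minus_commute)
      also have "\<dots> \<le> \<bar>measure lborel (t ` J) * K (t s) - integral (t ` J) K\<bar> * B"
        using B[OF ts] Kpos by (intro mult_left_mono) (simp_all add: pos_divide_le_eq)
      finally show ?thesis unfolding eq by (simp add: mult.commute)
    qed
    have "norm ((\<Sum>(s,k)\<in>p. measure lborel k *\<^sub>R ((1 / K (t s)) *\<^sub>R f (t s))) - (\<Sum>(x,k)\<in>?q. measure lborel k *\<^sub>R f x))
        = norm (\<Sum>(s,J)\<in>p. measure lborel J *\<^sub>R ((1 / K (t s)) *\<^sub>R f (t s)) - measure lborel (t ` J) *\<^sub>R f (t s))"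
      by (subst sum.reindex[OF inj]) (simp add: sum_subtractf split_def)
    also have "\<dots> \<le> (\<Sum>(s,J)\<in>p. B * norm (measure lborel (t ` J) *\<^sub>R K (t s) - integral (t ` J) K))"
    proof (rule sum_norm_le)
      fix x assume x: "x \<in> p"
      obtain s J where "x = (s, J)" by fastforce
      then show "norm (case x of (s,J) \<Rightarrow> measure lborel J *\<^sub>R ((1 / K (t s)) *\<^sub>R f (t s)) - measure lborel (t ` J) *\<^sub>R f (t s))
          \<le> (case x of (s,J) \<Rightarrow> B * norm (measure lborel (t ` J) *\<^sub>R K (t s) - integral (t ` J) K))"
        using tag_bound[of s J] x by (simp only: prod.case)
    qed
    also have "\<dots> = B * (\<Sum>(x,k)\<in>?q. norm (measure lborel k *\<^sub>R K x - integral k K))"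
      by (subst sum.reindex[OF inj]) (simp add: sum_distrib_left split_def)
    also have "\<dots> \<le> B * (e / (2 * (B + 1)))"
    proof (rule mult_left_mono[OF less_imp_le B0])
      show "(\<Sum>(x,k)\<in>?q. norm (measure lborel k *\<^sub>R K x - integral k K)) < e / (2 * (B + 1))"
        using K2[OF _ fine(2)] q by (simp only: tagged_division_of_def)
    qed
    also have "\<dots> \<le> e / 2" using e B0 by (simp add: field_simps)
    finally have 1: "norm ((\<Sum>(s,k)\<in>p. measure lborel k *\<^sub>R ((1 / K (t s)) *\<^sub>R f (t s))) - (\<Sum>(x,k)\<in>?q. measure lborel k *\<^sub>R f x)) \<le> e/2" .
    have "norm ((\<Sum>(s,k)\<in>p. measure lborel k *\<^sub>R ((1 / K (t s)) *\<^sub>R f (t s))) - I)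
      \<le> norm ((\<Sum>(s,k)\<in>p. measure lborel k *\<^sub>R ((1 / K (t s)) *\<^sub>R f (t s))) - (\<Sum>(x,k)\<in>?q. measure lborel k *\<^sub>R f x))
        + norm ((\<Sum>(x,k)\<in>?q. measure lborel k *\<^sub>R f x) - I)"
      by (rule norm_diff_triangle_le[OF order_refl order_refl])
    then show ?thesis using 1 f1[OF q fine(1)] by linarith
  qed
  show "\<exists>\<gamma>. gauge \<gamma> \<and> (\<forall>\<D>. \<D> tagged_division_of {0..S c} \<and> \<gamma> fine \<D> \<longrightarrow>
        norm ((\<Sum>(s,k)\<in>\<D>. measure lborel k *\<^sub>R ((1 / K (t s)) *\<^sub>R f (t s))) - I) < e)"
    by (intro exI[of _ "\<gamma>'"] conjI gauge allI impI, elim conjE, rule fine_bound)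
qed

text \<open>Substitution applied to \<open>g\<close> composed with \<open>S\<close>; a bound
  \<open>B\<close> for \<open>g\<close> becomes the required multiple \<open>B / m * K u\<close>
  because \<open>K \<ge> m\<close>. This supplies the integrability of weighted continuous functions
  although the weight itself need not be continuous.\<close>

lemma weight_continuous_has_integral:
  fixes g :: "real \<Rightarrow> 'a::banach"
  assumes c: "c \<in> {0..T}" and g: "continuous_on {0..S c} g"
  shows "((\<lambda>s. (1 / K (t s)) *\<^sub>R g s) has_integral integral {0..c} (\<lambda>u. g (S u))) {0..S c}"
proof -
  have gS: "continuous_on {0..c} (\<lambda>u. g (S u))"
    using S_image[OF c] c
    by (intro continuous_on_compose2[OF g] continuous_on_subset[OF S_continuous]) auto
  obtain B where "\<forall>x\<in>(\<lambda>u. g (S u)) ` {0..c}. norm x \<le> B"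
    using compact_imp_bounded[OF compact_continuous_image[OF gS compact_Icc]]
    unfolding bounded_iff by blast
  then have B: "\<And>u. u \<in> {0..c} \<Longrightarrow> norm (g (S u)) \<le> B" by blast
  have "((\<lambda>s. (1 / K (t s)) *\<^sub>R g (S (t s))) has_integral integral {0..c} (\<lambda>u. g (S u))) {0..S c}"
  proof (rule has_integral_time_change[OF c])
    show "((\<lambda>u. g (S u)) has_integral integral {0..c} (\<lambda>u. g (S u))) {0..c}"
      using integrable_continuous_real[OF gS] by (rule integrable_integral)
    fix u assume u: "u \<in> {0..c}"
    have "0 \<le> B" using B[OF u] norm_ge_zero order_trans by blast
    then have "B * m \<le> B * K u"
      using K_ge[of u] u c by (intro mult_left_mono) auto
    moreover have "norm (g (S u)) * m \<le> B * m" using B[OF u] m by (intro mult_right_mono) auto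
    ultimately have "norm (g (S u)) * m \<le> B * K u" by linarith
    then show "norm (g (S u)) \<le> B / m * K u" using m by (simp add: field_simps)
  qed
  then show ?thesis
    using S_in[OF c] by (elim has_integral_eq[rotated]) auto
qed

lemma weight_has_integral: "((\<lambda>s. 1 / K (t s)) has_integral T) {0..S T}"
  using weight_continuous_has_integral[of T "\<lambda>_. 1::real"] T by simp

end

section \<open>Gronwall estimates\<close>

text \<open>Bootstrap: the integral equation makes \<open>x\<close> continuous, the hypothesis then
  makes the integrand continuous, and the fundamental theorem of calculus gives a derivative at
  every point instead of almost every point. It is meant for the linear equation of the fundamental
  matrix.\<close>

lemma ode_solution_has_vector_derivative:
  fixes x :: "real \<Rightarrow> 'a::banach"
  assumes x: "ode_solution f a b x"
    and f: "\<And>y. continuous_on {a..b} y \<Longrightarrow> continuous_on {a..b} (\<lambda>t. f t (y t))"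
    and t: "t \<in> {a..b}"
  shows "(x has_vector_derivative f t (x t)) (at t within {a..b})"
proof -
  have int: "((\<lambda>t. f t (x t)) has_integral x c - x a) {a..c}" if "c \<in> {a..b}" for c
    using ode_solution_has_integral[OF x that] .
  have eq: "x c = x a + integral {a..c} (\<lambda>t. f t (x t))" if "c \<in> {a..b}" for c
    using integral_unique[OF int[OF that]] by simp
  have "continuous_on {a..b} (\<lambda>c. x a + integral {a..c} (\<lambda>t. f t (x t)))"
    using int[of b] t by (intro continuous_intros indefinite_integral_continuous_1) (auto intro: has_integral_integrable)
  then have "continuous_on {a..b} x"
    by (rule continuous_on_eq) (rule eq[symmetric])
  then have "((\<lambda>c. integral {a..c} (\<lambda>t. f t (x t))) has_vector_derivative f t (x t)) (at t within {a..b})"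
    using t by (intro integral_has_vector_derivative f)
  then have "((\<lambda>c. x a + integral {a..c} (\<lambda>t. f t (x t))) has_vector_derivative f t (x t)) (at t within {a..b})"
    by (rule has_vector_derivative_eq_rhs[OF has_vector_derivative_add[OF has_vector_derivative_const]]) simp
  then show ?thesis
    by (rule has_vector_derivative_transform[OF t, rotated]) (rule eq)
qed

text \<open>The integrating factor is applied to the majorant
  \<open>c + B * integral {0..s} g\<close>, which is differentiable, whereas \<open>g\<close> is
  only continuous.\<close>

lemma gronwall_integral:
  fixes g :: "real \<Rightarrow> real"
  assumes g: "continuous_on {0..L} g" and B: "0 \<le> B"
    and le: "\<And>s. s \<in> {0..L} \<Longrightarrow> g s \<le> c + B * integral {0..s} g"
    and s: "s \<in> {0..L}"
  shows "g s \<le> c * exp (B * s)"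
proof -
  define v where "v r = (c + B * integral {0..r} g) * exp (- (B * r))" for r
  have d: "(v has_real_derivative B * (g r - (c + B * integral {0..r} g)) * exp (- (B * r))) (at r within {0..L})"
    if "r \<in> {0..L}" for r
    unfolding v_def using integral_has_real_derivative[OF g that]
    by (auto intro!: derivative_eq_intros simp: algebra_simps)
  have "v s \<le> v 0"
  proof (rule DERIV_nonpos_imp_decreasing_open[of 0 s v])
    fix r assume r: "0 < r" "r < s"
    have "B * (g r - (c + B * integral {0..r} g)) * exp (- (B * r)) \<le> 0"
      using le[of r] r s B by (intro mult_nonpos_nonneg mult_nonneg_nonpos) auto
    then show "\<exists>y. (v has_real_derivative y) (at r) \<and> y \<le> 0"
      using d[of r] r s at_within_Icc_at[of 0 r L] by auto
  next
    have "continuous_on {0..L} v"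
      unfolding continuous_on_eq_continuous_within using d DERIV_continuous by blast
    then show "continuous_on {0..s} v" using s by (auto elim: continuous_on_subset)
  qed (use s in auto)
  then have "c + B * integral {0..s} g \<le> c * exp (B * s)"
    by (simp add: v_def exp_minus field_simps)
  then show ?thesis using le[OF s] by linarith
qed

text \<open>The squared norm times \<open>exp (-2 * C * x)\<close> decreases and times
  \<open>exp (2 * C * x)\<close> increases; the square is differentiable also where \<open>W\<close>
  vanishes. The bound therefore runs forwards and backwards from \<open>r\<close>, and for
  \<open>W r = 0\<close> it is a uniqueness statement.\<close>

lemma norm_growth_bound:
  fixes W :: "real \<Rightarrow> 'a::real_inner"
  assumes W: "\<And>s. s \<in> {a..b} \<Longrightarrow> (W has_vector_derivative W' s) (at s within {a..b})"
    and bd: "\<And>s. s \<in> {a..b} \<Longrightarrow> norm (W' s) \<le> C * norm (W s)"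
    and r: "r \<in> {a..b}" and s: "s \<in> {a..b}"
  shows "norm (W s) \<le> exp (C * \<bar>s - r\<bar>) * norm (W r)"
proof -
  have d: "((\<lambda>x. exp (k * x) * (W x \<bullet> W x)) has_real_derivative
      exp (k * x) * (k * (W x \<bullet> W x) + 2 * (W x \<bullet> W' x))) (at x within {a..b})"
    if "x \<in> {a..b}" for x k
  proof -
    have "((\<lambda>x. W x \<bullet> W x) has_derivative (\<lambda>h. W x \<bullet> (h *\<^sub>R W' x) + (h *\<^sub>R W' x) \<bullet> W x)) (at x within {a..b})"
      using W[OF that] unfolding has_vector_derivative_def by (intro has_derivative_inner)
    then have "((\<lambda>x. W x \<bullet> W x) has_real_derivative 2 * (W x \<bullet> W' x)) (at x within {a..b})"
      unfolding has_field_derivative_def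
      by (rule has_derivative_eq_rhs) (auto simp: fun_eq_iff inner_commute)
    then show ?thesis
      by (auto intro!: derivative_eq_intros simp: algebra_simps)
  qed
  have cont: "continuous_on {a..b} (\<lambda>x. exp (k * x) * (W x \<bullet> W x))" for k
    unfolding continuous_on_eq_continuous_within using d DERIV_continuous by blast
  have ip: "\<bar>W x \<bullet> W' x\<bar> \<le> C * (W x \<bullet> W x)" if "x \<in> {a..b}" for x
  proof -
    have "\<bar>W x \<bullet> W' x\<bar> \<le> norm (W x) * norm (W' x)" by (rule Cauchy_Schwarz_ineq2)
    also have "\<dots> \<le> norm (W x) * (C * norm (W x))" by (intro mult_left_mono bd that) auto
    finally show ?thesis by (simp add: dot_square_norm power2_eq_square mult_ac)
  qed
  \<comment> \<open>\<open>k\<close> will be \<open>-2 * C\<close> for \<open>r \<le> s\<close> and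
    \<open>2 * C\<close> otherwise; the factor 2 disappears on taking square roots.\<close>
  have fin: "norm (W s) \<le> exp (C * \<bar>s - r\<bar>) * norm (W r)"
    if "exp (k * s) * (W s \<bullet> W s) \<le> exp (k * r) * (W r \<bullet> W r)" "k * (r - s) = 2 * (C * \<bar>s - r\<bar>)" for k
  proof -
    have "W s \<bullet> W s \<le> exp (k * (r - s)) * (W r \<bullet> W r)"
      using that(1) by (simp add: exp_diff field_simps)
    also have "\<dots> = (exp (C * \<bar>s - r\<bar>) * norm (W r))\<^sup>2"
      unfolding that(2) by (simp add: power_mult_distrib dot_square_norm exp_double)
    finally have "(norm (W s))\<^sup>2 \<le> (exp (C * \<bar>s - r\<bar>) * norm (W r))\<^sup>2"
      by (simp add: dot_square_norm)
    then show ?thesis by (rule power2_le_imp_le) simp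
  qed
  show ?thesis
  proof (cases "r \<le> s")
    case True
    have "exp (-2 * C * s) * (W s \<bullet> W s) \<le> exp (-2 * C * r) * (W r \<bullet> W r)"
    proof (rule DERIV_nonpos_imp_decreasing_open[OF True, where f = "\<lambda>x. exp (-2 * C * x) * (W x \<bullet> W x)"])
      fix x assume x: "r < x" "x < s"
      then have xa: "x \<in> {a..b}" "a < x" "x < b" using r s by auto
      have "exp (-2 * C * x) * (-2 * C * (W x \<bullet> W x) + 2 * (W x \<bullet> W' x)) \<le> 0"
        using ip[OF xa(1)] by (intro mult_nonneg_nonpos) auto
      then show "\<exists>y. ((\<lambda>x. exp (-2 * C * x) * (W x \<bullet> W x)) has_real_derivative y) (at x) \<and> y \<le> 0"
        using d[OF xa(1), of "-2 * C"] at_within_Icc_at[OF xa(2,3)] by auto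
    next
      show "continuous_on {r..s} (\<lambda>x. exp (-2 * C * x) * (W x \<bullet> W x))"
        by (rule continuous_on_subset[OF cont]) (use r s in auto)
    qed
    then show ?thesis by (rule fin) (use True in \<open>simp add: algebra_simps\<close>)
  next
    case False
    have "exp (2 * C * s) * (W s \<bullet> W s) \<le> exp (2 * C * r) * (W r \<bullet> W r)"
    proof (rule DERIV_nonneg_imp_increasing_open[where f = "\<lambda>x. exp (2 * C * x) * (W x \<bullet> W x)"])
      fix x assume x: "s < x" "x < r"
      then have xa: "x \<in> {a..b}" "a < x" "x < b" using r s by auto
      have "0 \<le> exp (2 * C * x) * (2 * C * (W x \<bullet> W x) + 2 * (W x \<bullet> W' x))"
        using ip[OF xa(1)] by (intro mult_nonneg_nonneg) auto
      then show "\<exists>y. ((\<lambda>x. exp (2 * C * x) * (W x \<bullet> W x)) has_real_derivative y) (at x) \<and> 0 \<le> y"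
        using d[OF xa(1), of "2 * C"] at_within_Icc_at[OF xa(2,3)] by auto
    next
      show "continuous_on {s..r} (\<lambda>x. exp (2 * C * x) * (W x \<bullet> W x))"
        by (rule continuous_on_subset[OF cont]) (use r s in auto)
    qed (use False in auto)
    then show ?thesis by (rule fin) (use False in \<open>simp add: algebra_simps\<close>)
  qed
qed

section \<open>Lipschitz and constancy criteria\<close>

lemma vector_derivative_bound_imp_Lipschitz:
  fixes f :: "real \<Rightarrow> 'a::real_normed_vector"
  assumes "\<And>x. x \<in> {a..b} \<Longrightarrow> (f has_vector_derivative f' x) (at x within {a..b})"
    and "\<And>x. x \<in> {a..b} \<Longrightarrow> norm (f' x) \<le> B"
    and "x \<in> {a..b}" "y \<in> {a..b}"
  shows "norm (f x - f y) \<le> B * \<bar>x - y\<bar>"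
proof -
  have "norm (f x - f y) \<le> B * norm (x - y)"
  proof (rule differentiable_bound[of "{a..b}" f "\<lambda>x h. h *\<^sub>R f' x"])
    fix x assume x: "x \<in> {a..b}"
    show "(f has_derivative (\<lambda>h. h *\<^sub>R f' x)) (at x within {a..b})"
      using assms(1)[OF x] by (simp add: has_vector_derivative_def)
    have "0 \<le> B" using assms(2)[OF x] norm_ge_zero order_trans by blast
    then show "onorm (\<lambda>h. h *\<^sub>R f' x) \<le> B"
      using assms(2)[OF x] by (intro onorm_bound) (auto simp: mult.commute[of B] intro: mult_left_mono)
  qed (use assms in auto)
  then show ?thesis by simp
qed

text \<open>Increments of second order force the derivative to vanish everywhere. With this
  criterion an identity can be proved by comparing its two sides over short intervals, without
  differentiating either.\<close>

lemma quadratic_increments_imp_const: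
  fixes E :: "real \<Rightarrow> 'a::real_normed_vector"
  assumes ab: "a \<le> b"
    and E: "\<And>r s. a \<le> r \<Longrightarrow> r \<le> s \<Longrightarrow> s \<le> b \<Longrightarrow> norm (E s - E r) \<le> Q * (s - r)\<^sup>2"
  shows "E b = E a"
proof -
  \<comment> \<open>Symmetrised in \<open>r\<close> and \<open>s\<close>, since the derivative
    within the interval looks to both sides; the absolute value makes the constant nonnegative
    whatever the sign of \<open>Q\<close>.\<close>
  have E': "norm (E s - E r) \<le> \<bar>Q\<bar> * (s - r)\<^sup>2" if "r \<in> {a..b}" "s \<in> {a..b}" for r s
  proof -
    have "norm (E s - E r) \<le> Q * (s - r)\<^sup>2"
      using E[of r s] E[of s r] that by (cases "r \<le> s") (auto simp: norm_minus_commute power2_commute)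
    also have "\<dots> \<le> \<bar>Q\<bar> * (s - r)\<^sup>2" by (intro mult_right_mono) auto
    finally show ?thesis .
  qed
  have "(E has_vector_derivative 0) (at r within {a..b})" if r: "r \<in> {a..b}" for r
    unfolding has_vector_derivative_def has_derivative_within_alt
  proof (intro conjI allI impI)
    fix e :: real assume e: "0 < e"
    have "norm (E s - E r - (s - r) *\<^sub>R 0) \<le> e * norm (s - r)"
      if s: "s \<in> {a..b}" "norm (s - r) < e / (\<bar>Q\<bar> + 1)" for s
    proof -
      have "\<bar>Q\<bar> * norm (s - r) \<le> (\<bar>Q\<bar> + 1) * norm (s - r)" by (intro mult_right_mono) auto
      also have "\<dots> \<le> e" using s(2) by (simp add: field_simps)
      finally have "(\<bar>Q\<bar> * norm (s - r)) * norm (s - r) \<le> e * norm (s - r)"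
        by (intro mult_right_mono) auto
      moreover have "(\<bar>Q\<bar> * norm (s - r)) * norm (s - r) = \<bar>Q\<bar> * (s - r)\<^sup>2"
        by (simp add: power2_eq_square abs_mult_self_eq mult.assoc)
      ultimately show ?thesis using E'[OF r s(1)] by (simp only: scaleR_zero_right diff_zero)
    qed
    then show "\<exists>d>0. \<forall>s\<in>{a..b}. norm (s - r) < d \<longrightarrow> norm (E s - E r - (s - r) *\<^sub>R 0) \<le> e * norm (s - r)"
      using e by (intro exI[of _ "e / (\<bar>Q\<bar> + 1)"]) auto
  qed simp
  then obtain c where "\<And>x. x \<in> {a..b} \<Longrightarrow> E x = c"
    using has_vector_derivative_zero_constant[of "{a..b}" E] by (metis convex_closed_interval convex_real_interval(5))
  then show ?thesis using ab by auto
qed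

section \<open>Matrix products as bounded bilinear maps\<close>

lemma bounded_bilinear_matrix_mult:
  "bounded_bilinear ((**) :: real^'m^'n \<Rightarrow> real^'k^'m \<Rightarrow> real^'k^'n)"
  unfolding bilinear_conv_bounded_bilinear[symmetric] bilinear_def
  by (auto intro!: linearI simp: vec_eq_iff matrix_matrix_mult_def sum.distrib sum_distrib_left algebra_simps)

lemma bounded_bilinear_matrix_vector_mult:
  "bounded_bilinear ((*v) :: real^'m^'n \<Rightarrow> real^'m \<Rightarrow> real^'n)"
  unfolding bilinear_conv_bounded_bilinear[symmetric] bilinear_def
  by (auto intro!: linearI simp: matrix_vector_mult_add_rdistrib matrix_vector_right_distrib matrix_vector_mult_scaleR scaleR_matrix_vector_assoc[symmetric])

section \<open>Variation of constants\<close>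

locale fundamental =
  fixes A :: "real \<Rightarrow> real^'n^'n" and L :: real and M :: "real \<Rightarrow> real \<Rightarrow> real^'n^'n"
  assumes L: "0 \<le> L" and A: "continuous_on {0..L} A" and M: "fundamental_matrix A 0 L M"
begin

lemma M_refl: "u \<in> {0..L} \<Longrightarrow> M u u = mat 1"
  using M by (simp add: fundamental_matrix_def)

lemma M_deriv:
  assumes "u \<in> {0..L}" "s \<in> {0..L}"
  shows "((\<lambda>s. M s u) has_vector_derivative A s ** M s u) (at s within {0..L})"
proof (rule ode_solution_has_vector_derivative[OF _ _ assms(2)])
  show "ode_solution (\<lambda>s X. A s ** X) 0 L (\<lambda>s. M s u)"
    using M assms by (simp add: fundamental_matrix_def)
qed (intro bounded_bilinear.continuous_on[OF bounded_bilinear_matrix_mult] A)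

lemma M_has_integral:
  assumes "u \<in> {0..L}" "0 \<le> a" "a \<le> b" "b \<le> L"
  shows "((\<lambda>s. A s ** M s u) has_integral M b u - M a u) {a..b}"
  by (rule fundamental_theorem_of_calculus[OF assms(3)])
    (rule has_vector_derivative_within_subset[OF M_deriv], use assms in auto)

lemma A_mult_bound:
  obtains c where "0 \<le> c" "\<And>s X. s \<in> {0..L} \<Longrightarrow> norm (A s ** (X :: real^'n^'n)) \<le> c * norm X"
    "\<And>s x. s \<in> {0..L} \<Longrightarrow> norm (A s *v x) \<le> c * norm x"
proof -
  obtain a where a: "\<forall>x\<in>A ` {0..L}. norm x \<le> a"
    using compact_imp_bounded[OF compact_continuous_image[OF A compact_Icc]]
    unfolding bounded_iff by blast
  obtain k where k: "0 \<le> k" "\<And>X Y. norm ((X::real^'n^'n) ** (Y::real^'n^'n)) \<le> norm X * norm Y * k"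
    using bounded_bilinear.nonneg_bounded[OF bounded_bilinear_matrix_mult] by blast
  obtain l where l: "0 \<le> l" "\<And>X y. norm ((X::real^'n^'n) *v y) \<le> norm X * norm y * l"
    using bounded_bilinear.nonneg_bounded[OF bounded_bilinear_matrix_vector_mult] by blast
  have "0 \<in> {0..L}" using L by simp
  then have a0: "0 \<le> a" using a norm_ge_zero[of "A 0"] order_trans by blast
  show ?thesis
  \<comment> \<open>One constant serves both products: \<open>k\<close> and \<open>l\<close> are
    their bilinear bounds, and the sum dominates either multiple.\<close>
  proof (rule that[of "a * k + a * l"])
    fix s and X :: "real^'n^'n" assume s: "s \<in> {0..L}"
    have "norm (A s ** X) \<le> norm (A s) * norm X * k" by (rule k)
    also have "\<dots> \<le> a * norm X * k" using a s k by (intro mult_right_mono) auto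
    also have "\<dots> \<le> (a * k + a * l) * norm X" using a0 l by (simp add: algebra_simps)
    finally show "norm (A s ** X) \<le> (a * k + a * l) * norm X" .
  next
    fix s and x :: "real^'n" assume s: "s \<in> {0..L}"
    have "norm (A s *v x) \<le> norm (A s) * norm x * l" by (rule l)
    also have "\<dots> \<le> a * norm x * l" using a s l by (intro mult_right_mono) auto
    also have "\<dots> \<le> (a * k + a * l) * norm x" using a0 k by (simp add: algebra_simps)
    finally show "norm (A s *v x) \<le> (a * k + a * l) * norm x" .
  qed (use a0 k l in auto)
qed

text \<open>As functions of \<open>r\<close>, both sides solve the same linear equation and agree at
  \<open>r = s\<close>. The growth bound, valid on both sides of \<open>s\<close>, forces their
  difference to vanish, so no ordering of the three times is required.\<close>

lemma M_cocycle:
  assumes r: "r \<in> {0..L}" and s: "s \<in> {0..L}" and u: "u \<in> {0..L}"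
  shows "M r s ** M s u = M r u"
proof -
  obtain c where c: "\<And>s X. s \<in> {0..L} \<Longrightarrow> norm (A s ** (X :: real^'n^'n)) \<le> c * norm X"
    using A_mult_bound by metis
  define W where "W x = M x s ** M s u - M x u" for x
  have "(W has_vector_derivative A x ** W x) (at x within {0..L})" if "x \<in> {0..L}" for x
  proof -
    have "((\<lambda>x. M x s ** M s u) has_vector_derivative (A x ** M x s) ** M s u) (at x within {0..L})"
      by (rule bounded_linear.has_vector_derivative[OF
            bounded_bilinear.bounded_linear_left[OF bounded_bilinear_matrix_mult] M_deriv[OF s that]])
    from has_vector_derivative_diff[OF this M_deriv[OF u that]]
    show ?thesis
      unfolding W_def bounded_bilinear.diff_right[OF bounded_bilinear_matrix_mult] matrix_mul_assoc .
  qed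
  from norm_growth_bound[OF this c s r]
  have "norm (W r) \<le> exp (c * \<bar>r - s\<bar>) * norm (W s)" by blast
  moreover have "W s = 0" using M_refl[OF s] by (simp add: W_def)
  ultimately show ?thesis by (simp add: W_def)
qed

text \<open>The first bound is exponential growth from the identity on the diagonal. It bounds the
  derivative \<open>A r ** M r s\<close>, and integrating away from the diagonal gives the Lipschitz
  estimate.\<close>

lemma M_norm_bounds:
  obtains c where "0 \<le> c" "\<And>r s. r \<in> {0..L} \<Longrightarrow> s \<in> {0..L} \<Longrightarrow> norm (M r s) \<le> c"
    "\<And>r s. r \<in> {0..L} \<Longrightarrow> s \<in> {0..L} \<Longrightarrow> norm (M r s - mat 1) \<le> c * \<bar>r - s\<bar>"
proof -
  obtain a where a0: "0 \<le> a" and a: "\<And>s X. s \<in> {0..L} \<Longrightarrow> norm (A s ** (X :: real^'n^'n)) \<le> a * norm X"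
    using A_mult_bound by metis
  define m where "m = exp (a * L) * norm (mat 1 :: real^'n^'n)"
  have m: "norm (M r s) \<le> m" if r: "r \<in> {0..L}" and s: "s \<in> {0..L}" for r s
  proof -
    have "norm (M r s) \<le> exp (a * \<bar>r - s\<bar>) * norm (M s s)"
      using norm_growth_bound[OF M_deriv[OF s] a s r] .
    also have "\<dots> \<le> exp (a * L) * norm (M s s)"
      using r s a0 by (intro mult_right_mono) (auto intro!: mult_left_mono)
    finally show ?thesis using M_refl[OF s] by (simp add: m_def)
  qed
  have m0: "0 \<le> m" by (simp add: m_def)
  have am: "norm (A r ** M r s) \<le> a * m" if "r \<in> {0..L}" "s \<in> {0..L}" for r s
    using a[OF that(1)] m[OF that] a0 by (meson mult_left_mono order_trans)
  have l: "norm (M r s - mat 1) \<le> a * m * \<bar>r - s\<bar>" if r: "r \<in> {0..L}" and s: "s \<in> {0..L}" for r s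
    using vector_derivative_bound_imp_Lipschitz[OF M_deriv[OF s] am[OF _ s] r s] M_refl[OF s] by simp
  show ?thesis
  proof (rule that[of "m + a * m"])
    fix r s assume rs: "r \<in> {0..L}" "s \<in> {0..L}"
    show "norm (M r s) \<le> m + a * m" using m[OF rs] m0 a0 by (simp add: add_increasing2)
    have "a * m * \<bar>r - s\<bar> \<le> (m + a * m) * \<bar>r - s\<bar>" using m0 by (intro mult_right_mono) auto
    then show "norm (M r s - mat 1) \<le> (m + a * m) * \<bar>r - s\<bar>" using l[OF rs] by linarith
  qed (use m0 a0 in auto)
qed

lemma bounds:
  obtains c where "0 \<le> c"
    "\<And>r s x. r \<in> {0..L} \<Longrightarrow> s \<in> {0..L} \<Longrightarrow> norm (M r s *v x) \<le> c * norm x"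
    "\<And>r s x. r \<in> {0..L} \<Longrightarrow> s \<in> {0..L} \<Longrightarrow> norm (M r s *v x - x) \<le> c * \<bar>r - s\<bar> * norm x"
    "\<And>s x. s \<in> {0..L} \<Longrightarrow> norm (A s *v x) \<le> c * norm x"
proof -
  obtain a where a0: "0 \<le> a" and a: "\<And>s x. s \<in> {0..L} \<Longrightarrow> norm (A s *v x) \<le> a * norm x"
    using A_mult_bound by metis
  obtain m where m: "0 \<le> m" "\<And>r s. r \<in> {0..L} \<Longrightarrow> s \<in> {0..L} \<Longrightarrow> norm (M r s) \<le> m"
    "\<And>r s. r \<in> {0..L} \<Longrightarrow> s \<in> {0..L} \<Longrightarrow> norm (M r s - mat 1) \<le> m * \<bar>r - s\<bar>"
    using M_norm_bounds by metis
  obtain l where l: "0 \<le> l" "\<And>X y. norm ((X::real^'n^'n) *v y) \<le> norm X * norm y * l"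
    using bounded_bilinear.nonneg_bounded[OF bounded_bilinear_matrix_vector_mult] by blast
  have ml: "0 \<le> m * l" using m l by simp
  show ?thesis
  proof (rule that[of "a + m * l"])
    fix r s and x :: "real^'n" assume rs: "r \<in> {0..L}" "s \<in> {0..L}"
    have "norm (M r s *v x) \<le> norm (M r s) * norm x * l" by (rule l)
    also have "\<dots> \<le> m * norm x * l" using m(2)[OF rs] l by (intro mult_right_mono) auto
    also have "\<dots> \<le> (a + m * l) * norm x" using a0 by (simp add: algebra_simps)
    finally show "norm (M r s *v x) \<le> (a + m * l) * norm x" .
    have "M r s *v x - x = (M r s - mat 1) *v x"
      by (simp add: matrix_vector_mult_diff_rdistrib)
    then have "norm (M r s *v x - x) \<le> norm (M r s - mat 1) * norm x * l" using l(2) by simp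
    also have "\<dots> \<le> (m * \<bar>r - s\<bar>) * norm x * l" using m(3)[OF rs] l by (intro mult_right_mono) auto
    also have "\<dots> \<le> (a + m * l) * \<bar>r - s\<bar> * norm x" using a0 by (simp add: algebra_simps)
    finally show "norm (M r s *v x - x) \<le> (a + m * l) * \<bar>r - s\<bar> * norm x" .
  next
    fix s and x :: "real^'n" assume s: "s \<in> {0..L}"
    have "a * norm x \<le> (a + m * l) * norm x" using ml by (intro mult_right_mono) auto
    then show "norm (A s *v x) \<le> (a + m * l) * norm x" using a[OF s, of x] by linarith
  qed (use a0 ml in auto)
qed

text \<open>The cocycle identity turns a change of the second argument into a factor near the
  identity: \<open>M r y - M r x = M r x ** (M x y - mat 1)\<close>.\<close>

lemma M_continuous:
  assumes r: "r \<in> {0..L}"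
  shows "continuous_on {0..L} (M r)"
proof -
  obtain m where m: "0 \<le> m" "\<And>r s. r \<in> {0..L} \<Longrightarrow> s \<in> {0..L} \<Longrightarrow> norm (M r s) \<le> m"
    "\<And>r s. r \<in> {0..L} \<Longrightarrow> s \<in> {0..L} \<Longrightarrow> norm (M r s - mat 1) \<le> m * \<bar>r - s\<bar>"
    using M_norm_bounds by metis
  obtain k where k: "0 \<le> k" "\<And>X Y. norm ((X::real^'n^'n) ** (Y::real^'n^'n)) \<le> norm X * norm Y * k"
    using bounded_bilinear.nonneg_bounded[OF bounded_bilinear_matrix_mult] by blast
  have "(m * m * k)-lipschitz_on {0..L} (M r)"
  proof (rule lipschitz_onI)
    fix x y assume xy: "x \<in> {0..L}" "y \<in> {0..L}"
    have "M r y - M r x = M r x ** (M x y - mat 1)"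
      unfolding bounded_bilinear.diff_right[OF bounded_bilinear_matrix_mult] M_cocycle[OF r xy] by simp
    then have "dist (M r x) (M r y) \<le> norm (M r x) * norm (M x y - mat 1) * k"
      using k(2)[of "M r x" "M x y - mat 1"] by (metis dist_commute dist_norm)
    also have "\<dots> \<le> m * (m * \<bar>x - y\<bar>) * k"
      using m xy r k by (intro mult_right_mono mult_mono) auto
    finally show "dist (M r x) (M r y) \<le> m * m * k * dist x y" by (simp add: dist_real_def mult_ac)
  qed (use m k in auto)
  then show ?thesis by (rule lipschitz_on_continuous_on)
qed

text \<open>
  Since \<open>h\<close> is merely integrable, no pointwise derivative of \<open>d\<close> is used and there is no product rule for
  \<open>M L s *v d s\<close>. Instead the difference of the two sides, as a function of the upper limit, has
  increments of quadratic order, because \<open>d\<close> is Lipschitz and \<open>M b r\<close> is within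
  \<open>O(b - r)\<close> of the identity.
\<close>

lemma variation_of_constants:
  fixes h d :: "real \<Rightarrow> real^'n"
  assumes h: "\<And>s. s \<in> {0..L} \<Longrightarrow> (h has_integral d s) {0..s}"
    and H: "\<And>s. s \<in> {0..L} \<Longrightarrow> norm (h s) \<le> H"
    and Mh: "(\<lambda>s. M L s *v h s) integrable_on {0..L}"
  shows "((\<lambda>s. M L s *v (h s - A s *v d s)) has_integral d L) {0..L}"
proof -
  have LL: "L \<in> {0..L}" and O: "0 \<in> {0..L}" using L by auto
  obtain c where c0: "0 \<le> c"
    and cM: "\<And>r s x. r \<in> {0..L} \<Longrightarrow> s \<in> {0..L} \<Longrightarrow> norm (M r s *v x) \<le> c * norm x"
    and cM1: "\<And>r s x. r \<in> {0..L} \<Longrightarrow> s \<in> {0..L} \<Longrightarrow> norm (M r s *v x - x) \<le> c * \<bar>r - s\<bar> * norm x"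
    and cA: "\<And>s x. s \<in> {0..L} \<Longrightarrow> norm (A s *v x) \<le> c * norm x"
    using bounds by metis
  have H0: "0 \<le> H" using H[OF O] norm_ge_zero order_trans by blast
  have hd: "(h has_integral d s - d r) {r..s}" if "0 \<le> r" "r \<le> s" "s \<le> L" for r s
  proof -
    have hs: "h integrable_on {0..s}" using h[of s] that by (auto intro: has_integral_integrable)
    have "integral {0..r} h + integral {r..s} h = integral {0..s} h"
      by (rule Henstock_Kurzweil_Integration.integral_combine[OF that(1,2) hs])
    moreover have "integral {0..r} h = d r" "integral {0..s} h = d s"
      using h[of r] h[of s] that by (auto intro!: integral_unique)
    moreover have "h integrable_on {r..s}" by (rule integrable_on_subinterval[OF hs]) (use that in auto)
    ultimately show ?thesis by (metis add_diff_cancel_left' integrable_integral)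
  qed
  have dl: "norm (d s - d r) \<le> H * \<bar>s - r\<bar>" if "0 \<le> r" "r \<le> s" "s \<le> L" for r s
    using has_integral_bound_real[OF H0 _ hd[OF that], of "{}"] H that by auto
  have "(h has_integral d 0) {0}" using h[OF O] by simp
  then have d0: "d 0 = 0" using has_integral_refl(2) has_integral_unique by blast
  define D where "D = H * L"
  have dD: "norm (d s) \<le> D" if "s \<in> {0..L}" for s
  proof -
    have "norm (d s) \<le> H * s" using dl[of 0 s] that d0 by auto
    also have "\<dots> \<le> D" unfolding D_def using that H0 by (intro mult_left_mono) auto
    finally show ?thesis .
  qed
  have D0: "0 \<le> D" using H0 L by (simp add: D_def)
  have dcont: "continuous_on {0..L} d"
  proof -
    have "H-lipschitz_on {0..L} d"
    proof (rule lipschitz_onI[OF _ H0])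
      fix x y assume "x \<in> {0..L}" "y \<in> {0..L}"
      then show "dist (d x) (d y) \<le> H * dist x y"
        using dl[of x y] dl[of y x]
        by (cases "x \<le> y") (auto simp: dist_norm norm_minus_commute abs_minus_commute)
    qed
    then show ?thesis by (rule lipschitz_on_continuous_on)
  qed
  define g where "g s = M L s *v (h s - A s *v d s)" for s
  have "(\<lambda>s. M L s *v h s - M L s *v (A s *v d s)) integrable_on {0..L}"
    using M_continuous[OF LL] A dcont
    by (intro integrable_diff Mh integrable_continuous_real
          bounded_bilinear.continuous_on[OF bounded_bilinear_matrix_vector_mult])
  then have gint: "g integrable_on {0..L}"
    by (simp add: g_def[abs_def] matrix_vector_mult_diff_distrib)
  \<comment> \<open>The defect of the formula up to time \<open>s\<close>: \<open>E 0 = 0\<close>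
    because \<open>d 0 = 0\<close>, and \<open>E L = 0\<close> is the claim because
    \<open>M L L\<close> is the identity.\<close>
  define E where "E s = M L s *v d s - integral {0..s} g" for s
  \<comment> \<open>The four summands bound, in order, the four pieces into which the integrand of
    an increment of \<open>E\<close> is split below; the outer \<open>c\<close> bounds
    \<open>M L b\<close>.\<close>
  define Q where "Q = c * (c * H + c * (c * D) + c * H + c * (c * D))"
  have "norm (E b - E a) \<le> Q * (b - a)\<^sup>2" if ab: "0 \<le> a" "a \<le> b" "b \<le> L" for a b
  proof -
    have a: "a \<in> {0..L}" and b: "b \<in> {0..L}" using ab by auto
    have gab: "(g has_integral integral {0..b} g - integral {0..a} g) {a..b}"
    proof -
      have gb: "g integrable_on {0..b}" by (rule integrable_on_subinterval[OF gint]) (use b in auto)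
      have "integral {0..a} g + integral {a..b} g = integral {0..b} g"
        by (rule Henstock_Kurzweil_Integration.integral_combine[OF ab(1,2) gb])
      moreover have "g integrable_on {a..b}" by (rule integrable_on_subinterval[OF gb]) (use ab in auto)
      ultimately show ?thesis by (metis add_diff_cancel_left' integrable_integral)
    qed
    \<comment> \<open>With \<open>M L a = M L b ** M b a\<close>, the increment of \<open>E\<close>
      is \<open>M L b *v (d b - d a) - M L b *v ((M b a - M a a) *v d a)\<close> minus the integral
      of \<open>g\<close>. The two differences are integrals of \<open>h\<close> and of
      \<open>A r ** M r a\<close>, so the whole increment is a single integral.\<close>
    let ?k = "\<lambda>r. M L b *v h r - M L b *v ((A r ** M r a) *v d a) - g r"
    have "((\<lambda>r. M L b *v h r) has_integral M L b *v (d b - d a)) {a..b}"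
      using has_integral_linear[OF hd[OF ab] bounded_bilinear.bounded_linear_right[OF bounded_bilinear_matrix_vector_mult, of "M L b"]]
      by (simp add: o_def)
    moreover have "((\<lambda>r. M L b *v ((A r ** M r a) *v d a)) has_integral M L b *v ((M b a - M a a) *v d a)) {a..b}"
      using has_integral_linear[OF M_has_integral[OF a ab], OF bounded_linear_compose[OF
            bounded_bilinear.bounded_linear_right[OF bounded_bilinear_matrix_vector_mult, of "M L b"]
            bounded_bilinear.bounded_linear_left[OF bounded_bilinear_matrix_vector_mult, of "d a"]]]
      by (simp add: o_def)
    ultimately have "(?k has_integral M L b *v (d b - d a) - M L b *v ((M b a - M a a) *v d a)
          - (integral {0..b} g - integral {0..a} g)) {a..b}"
      by (intro has_integral_diff gab)
    moreover have "M L b *v (d b - d a) - M L b *v ((M b a - M a a) *v d a)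
          - (integral {0..b} g - integral {0..a} g) = E b - E a"
      using M_refl[OF a] M_cocycle[OF LL b a]
      by (simp add: E_def matrix_vector_mult_diff_distrib matrix_vector_mult_diff_rdistrib matrix_vector_mul_assoc)
    ultimately have kE: "(?k has_integral E b - E a) {a..b}" by simp
    have "norm (?k r) \<le> Q * (b - a)" if r: "r \<in> {a..b}" for r
    proof -
      have rL: "r \<in> {0..L}" using r ab by auto
      define x where "x = A r *v d r"
      have x: "norm x \<le> c * D"
        unfolding x_def using cA[OF rL, of "d r"] dD[OF rL] c0 by (meson mult_left_mono order_trans)
      have "M L r = M L b ** M b r" using M_cocycle[OF LL b rL] by simp
      \<comment> \<open>After factoring out \<open>M L b\<close>, each piece contains
        \<open>M b r\<close> or \<open>M r a\<close> compared with the identity, or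
        \<open>d r\<close> compared with \<open>d a\<close>. Each is of order \<open>b - a\<close>,
        and integration over \<open>{a..b}\<close> supplies the second such factor.\<close>
      then have eq: "?k r = M L b *v ((h r - M b r *v h r) + (M b r *v x - x)
            + A r *v (d r - d a) - A r *v (M r a *v d a - d a))"
        by (simp add: g_def x_def matrix_vector_mult_diff_distrib matrix_vector_right_distrib
            bounded_bilinear.minus_right[OF bounded_bilinear_matrix_vector_mult]
            flip: matrix_vector_mul_assoc)
      have 1: "norm (h r - M b r *v h r) \<le> c * (b - a) * H"
      proof -
        have "norm (h r - M b r *v h r) \<le> c * \<bar>b - r\<bar> * norm (h r)"
          using cM1[OF b rL, of "h r"] by (simp only: norm_minus_commute)
        also have "\<dots> \<le> c * (b - a) * H" using r c0 H[OF rL] by (intro mult_mono mult_left_mono) auto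
        finally show ?thesis .
      qed
      have 2: "norm (M b r *v x - x) \<le> c * (b - a) * (c * D)"
      proof -
        have "norm (M b r *v x - x) \<le> c * \<bar>b - r\<bar> * norm x" by (rule cM1[OF b rL])
        also have "\<dots> \<le> c * (b - a) * (c * D)" using r c0 x by (intro mult_mono mult_left_mono) auto
        finally show ?thesis .
      qed
      have 3: "norm (A r *v (d r - d a)) \<le> c * (H * (b - a))"
      proof -
        have "norm (d r - d a) \<le> H * \<bar>r - a\<bar>" using dl[of a r] r ab by auto
        also have "\<dots> \<le> H * (b - a)" using r H0 by (intro mult_left_mono) auto
        finally show ?thesis using cA[OF rL, of "d r - d a"] c0 by (meson mult_left_mono order_trans)
      qed
      have 4: "norm (A r *v (M r a *v d a - d a)) \<le> c * (c * (b - a) * D)"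
      proof -
        have "norm (M r a *v d a - d a) \<le> c * \<bar>r - a\<bar> * norm (d a)" by (rule cM1[OF rL a])
        also have "\<dots> \<le> c * (b - a) * D" using r c0 dD[OF a] by (intro mult_mono mult_left_mono) auto
        finally show ?thesis using cA[OF rL, of "M r a *v d a - d a"] c0 by (meson mult_left_mono order_trans)
      qed
      have "norm (?k r) \<le> c * norm ((h r - M b r *v h r) + (M b r *v x - x)
            + A r *v (d r - d a) - A r *v (M r a *v d a - d a))"
        unfolding eq by (rule cM[OF LL b])
      also have "\<dots> \<le> c * (c * (b - a) * H + c * (b - a) * (c * D) + c * (H * (b - a)) + c * (c * (b - a) * D))"
        by (rule mult_left_mono[OF norm_triangle_le_diff[OF add_mono[OF norm_triangle_le[OF add_mono[OF
                norm_triangle_le[OF add_mono[OF 1 2]] 3]] 4]] c0])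
      also have "\<dots> = Q * (b - a)" by (simp add: Q_def algebra_simps)
      finally show ?thesis .
    qed
    moreover have "0 \<le> Q * (b - a)" using c0 H0 D0 ab by (simp add: Q_def)
    ultimately have "norm (E b - E a) \<le> Q * (b - a) * (b - a)"
      using has_integral_bound_real[OF _ _ kE, of "Q * (b - a)" "{}"] ab by auto
    then show ?thesis by (simp add: power2_eq_square mult.assoc)
  qed
  then have "E L = E 0" by (rule quadratic_increments_imp_const[OF L])
  then have "d L = integral {0..L} g" using M_refl[OF LL] d0 by (simp add: E_def)
  then show ?thesis using integrable_integral[OF gint] unfolding g_def by simp
qed

end

section \<open>Vector fields on the torus\<close>

lemma periodic_shift_axis:
  fixes F :: "real^'n \<Rightarrow> 'b"
  assumes F: "\<And>x. F (x + axis i p) = F x"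
  shows "F (x + axis i (of_int k * p)) = F x"
proof -
  have nat: "F (x + axis i (of_nat n * p)) = F x" for n x
  proof (induction n)
    case 0
    have "axis i (of_nat 0 * p) = (0 :: real^'n)" by (simp add: axis_def vec_eq_iff)
    then show ?case by (simp only: add_0_right)
  next
    case (Suc n)
    have "axis i (of_nat (Suc n) * p) = axis i (of_nat n * p) + axis i p"
      by (simp add: axis_def vec_eq_iff algebra_simps)
    then have "F (x + axis i (of_nat (Suc n) * p)) = F ((x + axis i (of_nat n * p)) + axis i p)"
      by (simp only: add.assoc)
    then show ?case using F Suc by simp
  qed
  show ?thesis
  proof (cases k)
    case (nonneg n)
    then show ?thesis using nat by simp
  next
    case (neg n)
    \<comment> \<open>A negative multiple is undone by a positive shift, which is already
      treated.\<close>
    have x: "(x + axis i (of_int k * p)) + axis i (of_nat (Suc n) * p) = x"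
      unfolding neg by (simp add: axis_def vec_eq_iff algebra_simps)
    show ?thesis using nat[of "x + axis i (of_int k * p)" "Suc n"] unfolding x by (rule sym)
  qed
qed

lemma periodic_continuous_bounded:
  fixes F :: "real^'n \<Rightarrow> 'b::real_normed_vector"
  assumes per: "\<And>x i. F (x + axis i p) = F x" and p: "0 < p" and F: "continuous_on UNIV F"
  shows "bounded (range F)"
proof -
  have shift: "F (x + (\<Sum>i\<in>I. axis i (of_int (k i) * p))) = F x" if "finite I" for x I and k :: "'n \<Rightarrow> int"
    using that
  proof (induction I)
    case (insert i I)
    have "F (x + (\<Sum>i\<in>insert i I. axis i (of_int (k i) * p)))
        = F ((x + (\<Sum>i\<in>I. axis i (of_int (k i) * p))) + axis i (of_int (k i) * p))"
      using insert.hyps by (simp add: add_ac)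
    also have "\<dots> = F (x + (\<Sum>i\<in>I. axis i (of_int (k i) * p)))"
      by (rule periodic_shift_axis) (rule per)
    finally show ?case using insert.IH by simp
  qed simp
  have "range F \<subseteq> F ` cbox 0 (\<chi> i. p)"
  proof clarify
    fix x :: "real^'n"
    \<comment> \<open>Removing whole periods coordinatewise moves \<open>x\<close> into the closed
      cube of side \<open>p\<close>, where compactness bounds \<open>F\<close>.\<close>
    define k where "k i = - \<lfloor>x $ i / p\<rfloor>" for i :: 'n
    define y :: "real^'n" where "y = x + (\<Sum>i\<in>UNIV. axis i (of_int (k i) * p))"
    have yi: "y $ i = x $ i - of_int \<lfloor>x $ i / p\<rfloor> * p" for i
      by (simp add: y_def k_def axis_def sum_component)
    have "0 \<le> y $ i \<and> y $ i \<le> p" for i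
    proof -
      have "of_int \<lfloor>x $ i / p\<rfloor> * p \<le> x $ i" "x $ i \<le> (of_int \<lfloor>x $ i / p\<rfloor> + 1) * p"
        using p by (auto simp flip: pos_le_divide_eq pos_divide_le_eq)
      then show ?thesis unfolding yi by (simp add: algebra_simps)
    qed
    then have "y \<in> cbox 0 (\<chi> i. p)" by (simp add: mem_box_cart)
    moreover have "F y = F x" unfolding y_def by (rule shift) simp
    ultimately show "F x \<in> F ` cbox 0 (\<chi> i. p)" by (metis imageI)
  qed
  moreover have "bounded (F ` cbox 0 (\<chi> i. p))"
    using F by (intro compact_imp_bounded compact_continuous_image compact_cbox) (auto elim: continuous_on_subset)
  ultimately show ?thesis by (rule bounded_subset[rotated])
qed

lemma C1_torus_field_has_derivative:
  assumes "C1_torus_field F"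
  shows "(F has_derivative (\<lambda>h. jacobian F (at x) *v h)) (at x)"
  using assms by (simp add: C1_torus_field_def jacobian_works)

lemma C1_torus_field_continuous:
  assumes "C1_torus_field F"
  shows "continuous_on S F"
  using C1_torus_field_has_derivative[OF assms] has_derivative_continuous
  by (metis continuous_at_imp_continuous_on)

text \<open>Periodicity enters here. The bound does not depend on position, so speeds are bounded
  before anything is known about where a trajectory goes.\<close>

lemma C1_torus_field_bounded:
  assumes F: "C1_torus_field F"
  obtains B where "0 \<le> B" "\<And>x. norm (F x) \<le> B"
proof -
  have "bounded (range F)"
    using F C1_torus_field_continuous[OF F]
    by (intro periodic_continuous_bounded[of F "2 * pi"]) (auto simp: C1_torus_field_def)
  then obtain B where "\<And>x. norm (F x) \<le> B" unfolding bounded_iff by blast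
  then show ?thesis using that[of B] norm_ge_zero order_trans by blast
qed

text \<open>Mean value inequality with the Jacobian bounded by compactness. A ball suffices because
  the trajectories to be compared stay in a common one.\<close>

lemma C1_torus_field_Lipschitz:
  assumes F: "C1_torus_field F"
  obtains B where "0 \<le> B" "\<And>x y. x \<in> cball 0 R \<Longrightarrow> y \<in> cball 0 R \<Longrightarrow> norm (F x - F y) \<le> B * norm (x - y)"
proof -
  have "compact ((\<lambda>x. jacobian F (at x)) ` cball 0 R)"
    using F by (intro compact_continuous_image compact_cball) (auto simp: C1_torus_field_def elim: continuous_on_subset)
  then obtain j where j: "0 < j" "\<And>x. x \<in> cball 0 R \<Longrightarrow> norm (jacobian F (at x)) \<le> j"
    using compact_imp_bounded bounded_pos by (metis (no_types, lifting) imageI)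
  obtain l where l: "0 \<le> l" "\<And>X y. norm ((X::real^'a^'a) *v y) \<le> norm X * norm y * l"
    using bounded_bilinear.nonneg_bounded[OF bounded_bilinear_matrix_vector_mult] by blast
  show ?thesis
  proof (rule that[of "j * l"])
    fix x y :: "real^'a" assume xy: "x \<in> cball 0 R" "y \<in> cball 0 R"
    show "norm (F x - F y) \<le> j * l * norm (x - y)"
    proof (rule differentiable_bound[OF convex_cball _ _ xy])
      fix z :: "real^'a" assume z: "z \<in> cball 0 R"
      show "(F has_derivative (*v) (jacobian F (at z))) (at z within cball 0 R)"
        by (rule has_derivative_at_withinI[OF C1_torus_field_has_derivative[OF F]])
      show "onorm ((*v) (jacobian F (at z))) \<le> j * l"
      proof (rule onorm_bound)
        fix v
        have "norm (jacobian F (at z) *v v) \<le> norm (jacobian F (at z)) * norm v * l" by (rule l)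
        also have "\<dots> \<le> j * norm v * l" using j(2)[OF z] l by (intro mult_right_mono) auto
        finally show "norm (jacobian F (at z) *v v) \<le> j * l * norm v" by (simp add: mult_ac)
      qed (use j l in auto)
    qed
  qed (use j l in auto)
qed

text \<open>Uniform continuity of the Jacobian on a compact ball makes \<open>\<delta>\<close>
  independent of the base point. Applied along a trajectory, this replaces the second-derivative
  bound that a C^1 field may lack.\<close>

lemma C1_torus_field_linearization:
  assumes F: "C1_torus_field F" and \<eta>: "0 < \<eta>"
  obtains \<delta> where "0 < \<delta>" "\<And>x y. x \<in> cball 0 R \<Longrightarrow> y \<in> cball 0 R \<Longrightarrow> norm (x - y) < \<delta> \<Longrightarrow>
    norm (F x - F y - jacobian F (at y) *v (x - y)) \<le> \<eta> * norm (x - y)"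
proof -
  obtain l where l: "0 \<le> l" "\<And>X y. norm ((X::real^'a^'a) *v y) \<le> norm X * norm y * l"
    using bounded_bilinear.nonneg_bounded[OF bounded_bilinear_matrix_vector_mult] by blast
  have "uniformly_continuous_on (cball 0 R) (\<lambda>x. jacobian F (at x))"
    using F by (intro compact_uniformly_continuous compact_cball) (auto simp: C1_torus_field_def elim: continuous_on_subset)
  moreover have "0 < \<eta> / (l + 1)" using \<eta> l by simp
  ultimately obtain \<delta> where \<delta>: "0 < \<delta>" "\<And>x y. x \<in> cball 0 R \<Longrightarrow> y \<in> cball 0 R \<Longrightarrow> dist y x < \<delta> \<Longrightarrow>
      dist (jacobian F (at y)) (jacobian F (at x)) < \<eta> / (l + 1)"
    unfolding uniformly_continuous_on_def by metis
  show ?thesis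
  proof (rule that[OF \<delta>(1)])
    fix x y :: "real^'a" assume xy: "x \<in> cball 0 R" "y \<in> cball 0 R" "norm (x - y) < \<delta>"
    let ?S = "closed_segment y x"
    have "norm (F x - F y - jacobian F (at y) *v (x - y)) \<le> norm (x - y) * \<eta>"
    proof (rule differentiable_bound_linearization[where S = ?S and f' = "\<lambda>z. (*v) (jacobian F (at z))"])
      fix t :: real assume "t \<in> {0..1}"
      then show "y + t *\<^sub>R (x - y) \<in> ?S"
        unfolding in_segment by (intro exI[of _ t]) (auto simp: algebra_simps)
    next
      fix z assume z: "z \<in> ?S"
      show "(F has_derivative (*v) (jacobian F (at z))) (at z within ?S)"
        by (rule has_derivative_at_withinI[OF C1_torus_field_has_derivative[OF F]])
      have zR: "z \<in> cball 0 R"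
        using closed_segment_subset[OF xy(2,1) convex_cball] z by blast
      have "dist z y < \<delta>"
        using segment_bound(1)[OF z] xy(3) by (simp add: dist_norm norm_minus_commute)
      then have small: "norm (jacobian F (at z) - jacobian F (at y)) < \<eta> / (l + 1)"
        using \<delta>(2)[OF xy(2) zR] by (simp add: dist_norm)
      show "onorm ((*v) (jacobian F (at z)) - (*v) (jacobian F (at y))) \<le> \<eta>"
      proof (rule onorm_bound)
        fix v
        have "norm (((*v) (jacobian F (at z)) - (*v) (jacobian F (at y))) v)
            = norm ((jacobian F (at z) - jacobian F (at y)) *v v)"
          by (simp add: matrix_vector_mult_diff_rdistrib)
        also have "\<dots> \<le> norm (jacobian F (at z) - jacobian F (at y)) * norm v * l" by (rule l)
        also have "\<dots> \<le> \<eta> / (l + 1) * norm v * l" using small l by (intro mult_right_mono) auto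
        also have "\<dots> = (l / (l + 1)) * (\<eta> * norm v)" by simp
        also have "\<dots> \<le> 1 * (\<eta> * norm v)"
          using l \<eta> by (intro mult_right_mono) auto
        finally show "norm (((*v) (jacobian F (at z)) - (*v) (jacobian F (at y))) v) \<le> \<eta> * norm v" by simp
      qed (use \<eta> in auto)
    qed simp
    then show "norm (F x - F y - jacobian F (at y) *v (x - y)) \<le> \<eta> * norm (x - y)" by (simp add: mult.commute)
  qed
qed

section \<open>First-order response\<close>

text \<open>The problem after the change of time, with \<open>L\<close> for the new duration:
  \<open>K\<close> is visible only through the weight \<open>w\<close>, which is bounded and
  integrable against continuous functions. The identity at \<open>\<epsilon> = 0\<close> is
  uniqueness for the unperturbed flow.\<close>

lemma perturbation_has_vector_derivative:
  fixes F G :: "real^'n \<Rightarrow> real^'n" and w :: "real \<Rightarrow> real"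
    and \<phi> :: "real \<Rightarrow> real^'n" and z :: "real \<Rightarrow> real \<Rightarrow> real^'n"
  assumes F: "C1_torus_field F" and G: "C1_torus_field G" and L: "0 \<le> L"
    and w: "\<And>s. s \<in> {0..L} \<Longrightarrow> \<bar>w s\<bar> \<le> W"
    and w_int: "\<And>g :: real \<Rightarrow> real^'n. continuous_on {0..L} g \<Longrightarrow> (\<lambda>s. w s *\<^sub>R g s) integrable_on {0..L}"
    and \<phi>: "\<And>c. c \<in> {0..L} \<Longrightarrow> ((\<lambda>s. F (\<phi> s)) has_integral \<phi> c - x0) {0..c}"
    and z: "\<And>\<epsilon> c. c \<in> {0..L} \<Longrightarrow>
      ((\<lambda>s. F (z \<epsilon> s) + (\<epsilon> * w s) *\<^sub>R G (z \<epsilon> s)) has_integral z \<epsilon> c - x0) {0..c}"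
    and M: "fundamental_matrix (\<lambda>s. jacobian F (at (\<phi> s))) 0 L M"
  shows "((\<lambda>\<epsilon>. z \<epsilon> L) has_vector_derivative integral {0..L} (\<lambda>s. w s *\<^sub>R (M L s *v G (\<phi> s)))) (at 0)"
    and "z 0 L = \<phi> L"
proof -
  define A where "A s = jacobian F (at (\<phi> s))" for s
  define I where "I = integral {0..L} (\<lambda>s. w s *\<^sub>R (M L s *v G (\<phi> s)))"
  have LL: "L \<in> {0..L}" and O: "0 \<in> {0..L}" using L by auto
  have W0: "0 \<le> W" using w[OF O] by linarith
  have cont: "continuous_on {0..L} x"
    if "\<And>c. c \<in> {0..L} \<Longrightarrow> (f has_integral x c - x0) {0..c}" for x f :: "real \<Rightarrow> real^'n"
  proof -
    have "f integrable_on {0..L}" using that[OF LL] by (rule has_integral_integrable)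
    then have "continuous_on {0..L} (\<lambda>c. x0 + integral {0..c} f)"
      by (intro continuous_intros indefinite_integral_continuous_1)
    moreover have "x0 + integral {0..c} f = x c" if "c \<in> {0..L}" for c
      using integral_unique[OF \<open>\<And>c. c \<in> {0..L} \<Longrightarrow> (f has_integral x c - x0) {0..c}\<close>[OF that]] by simp
    ultimately show ?thesis by (rule continuous_on_eq)
  qed
  have \<phi>c: "continuous_on {0..L} \<phi>" using cont[OF \<phi>] .
  have zc: "continuous_on {0..L} (z \<epsilon>)" for \<epsilon> using cont[OF z] .
  have Ac: "continuous_on {0..L} A"
    unfolding A_def using F
    by (intro continuous_on_compose2[OF _ \<phi>c, of UNIV "\<lambda>x. jacobian F (at x)"]) (auto simp: C1_torus_field_def)
  interpret fundamental A L M
    by unfold_locales (use L Ac M in \<open>simp_all add: A_def[abs_def]\<close>)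

  obtain BF where BF: "0 \<le> BF" "\<And>x. norm (F x) \<le> BF" using C1_torus_field_bounded[OF F] by metis
  obtain BG where BG: "0 \<le> BG" "\<And>x. norm (G x) \<le> BG" using C1_torus_field_bounded[OF G] by metis
  have wG: "norm ((\<epsilon> * w s) *\<^sub>R G x) \<le> \<bar>\<epsilon>\<bar> * (W * BG)" if "s \<in> {0..L}" for \<epsilon> s x
  proof -
    have "\<bar>w s\<bar> * norm (G x) \<le> W * BG" using w[OF that] BG W0 by (intro mult_mono) auto
    then show ?thesis by (simp add: abs_mult mult.assoc mult_left_mono)
  qed
  \<comment> \<open>Initial norm plus maximal speed times duration. For
    \<open>\<bar>\<epsilon>\<bar> \<le> 1\<close> the perturbation adds at most
    \<open>W * BG\<close> to the speed, so one ball contains \<open>\<phi>\<close> and all these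
    \<open>z \<epsilon>\<close>.\<close>
  define R where "R = norm x0 + (BF + W * BG) * L"
  have inR: "x c \<in> cball 0 R"
    if "\<And>c. c \<in> {0..L} \<Longrightarrow> (f has_integral x c - x0) {0..c}"
      "\<And>s. s \<in> {0..L} \<Longrightarrow> norm (f s) \<le> BF + W * BG" "c \<in> {0..L}" for x f :: "real \<Rightarrow> real^'n" and c
  proof -
    have "norm (x c - x0) \<le> (BF + W * BG) * c"
      using has_integral_bound_real[OF _ _ that(1)[OF that(3)], of "BF + W * BG" "{}"] that(2,3) BF BG W0 by auto
    also have "\<dots> \<le> (BF + W * BG) * L" using that(3) BF BG W0 by (intro mult_left_mono) auto
    finally show ?thesis
      using norm_triangle_ineq[of "x c - x0" x0] by (simp add: R_def)
  qed
  have \<phi>R: "\<phi> s \<in> cball 0 R" if "s \<in> {0..L}" for s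
  proof (rule inR[OF \<phi> _ that])
    show "norm (F (\<phi> s)) \<le> BF + W * BG" for s
      using BF(2)[of "\<phi> s"] BG W0 by (simp add: add_increasing2)
  qed
  have zR: "z \<epsilon> s \<in> cball 0 R" if "s \<in> {0..L}" "\<bar>\<epsilon>\<bar> \<le> 1" for \<epsilon> s
  proof (rule inR[OF z _ that(1)])
    fix r assume r: "r \<in> {0..L}"
    have "\<bar>\<epsilon>\<bar> * (W * BG) \<le> 1 * (W * BG)" using that(2) BG W0 by (intro mult_right_mono) auto
    then show "norm (F (z \<epsilon> r) + (\<epsilon> * w r) *\<^sub>R G (z \<epsilon> r)) \<le> BF + W * BG"
      using norm_triangle_ineq[of "F (z \<epsilon> r)" "(\<epsilon> * w r) *\<^sub>R G (z \<epsilon> r)"] wG[OF r, of \<epsilon> "z \<epsilon> r"] BF(2)[of "z \<epsilon> r"]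
      by linarith
  qed
  obtain LF where LF: "0 \<le> LF" "\<And>x y. x \<in> cball 0 R \<Longrightarrow> y \<in> cball 0 R \<Longrightarrow> norm (F x - F y) \<le> LF * norm (x - y)"
    using C1_torus_field_Lipschitz[OF F] by metis
  obtain LG where LG: "0 \<le> LG" "\<And>x y. x \<in> cball 0 R \<Longrightarrow> y \<in> cball 0 R \<Longrightarrow> norm (G x - G y) \<le> LG * norm (x - y)"
    using C1_torus_field_Lipschitz[OF G] by metis
  define d where "d \<epsilon> s = z \<epsilon> s - \<phi> s" for \<epsilon> s
  define h where "h \<epsilon> s = F (z \<epsilon> s) - F (\<phi> s) + (\<epsilon> * w s) *\<^sub>R G (z \<epsilon> s)" for \<epsilon> s
  have hd: "(h \<epsilon> has_integral d \<epsilon> c) {0..c}" if "c \<in> {0..L}" for \<epsilon> c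
    using has_integral_diff[OF z[OF that, of \<epsilon>] \<phi>[OF that]]
    by (simp add: h_def[abs_def] d_def algebra_simps)
  have dc: "continuous_on {0..L} (d \<epsilon>)" for \<epsilon>
    unfolding d_def[abs_def] by (intro continuous_intros zc \<phi>c)
  \<comment> \<open>Gronwall constant: a forcing of size at most
    \<open>\<bar>\<epsilon>\<bar> * (W * BG)\<close> acts over length \<open>L\<close> and is
    amplified by at most \<open>exp (LF * L)\<close>.\<close>
  define C where "C = W * BG * L * exp (LF * L)"
  have C0: "0 \<le> C" using W0 BG L by (simp add: C_def)
  have dC: "norm (d \<epsilon> s) \<le> \<bar>\<epsilon>\<bar> * C" if s: "s \<in> {0..L}" and \<epsilon>: "\<bar>\<epsilon>\<bar> \<le> 1" for \<epsilon> s
  proof -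
    define \<kappa> where "\<kappa> = \<bar>\<epsilon>\<bar> * (W * BG)"
    have \<kappa>0: "0 \<le> \<kappa>" using W0 BG by (simp add: \<kappa>_def)
    have nc: "continuous_on {0..L} (\<lambda>s. norm (d \<epsilon> s))" by (intro continuous_intros dc)
    have "norm (d \<epsilon> c) \<le> \<kappa> * L + LF * integral {0..c} (\<lambda>s. norm (d \<epsilon> s))" if c: "c \<in> {0..L}" for c
    proof -
      have ni: "(\<lambda>s. norm (d \<epsilon> s)) integrable_on {0..c}"
        using c by (intro integrable_continuous_real continuous_on_subset[OF nc]) auto
      have "((\<lambda>_. \<kappa>) has_integral c * \<kappa>) {0..c}"
        using has_integral_const_real[of \<kappa> 0 c] c by simp
      then have bi: "((\<lambda>s. \<kappa> + LF * norm (d \<epsilon> s)) has_integral c * \<kappa> + LF * integral {0..c} (\<lambda>s. norm (d \<epsilon> s))) {0..c}"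
        by (intro has_integral_add has_integral_mult_right integrable_integral ni)
      have "norm (integral {0..c} (h \<epsilon>)) \<le> integral {0..c} (\<lambda>s. \<kappa> + LF * norm (d \<epsilon> s))"
      proof (rule integral_norm_bound_integral)
        show "h \<epsilon> integrable_on {0..c}" using hd[OF c] by (rule has_integral_integrable)
        show "(\<lambda>s. \<kappa> + LF * norm (d \<epsilon> s)) integrable_on {0..c}" using bi by (rule has_integral_integrable)
        fix s assume "s \<in> {0..c}"
        then have s: "s \<in> {0..L}" using c by auto
        show "norm (h \<epsilon> s) \<le> \<kappa> + LF * norm (d \<epsilon> s)"
          using norm_triangle_ineq[of "F (z \<epsilon> s) - F (\<phi> s)" "(\<epsilon> * w s) *\<^sub>R G (z \<epsilon> s)"]
            LF(2)[OF zR[OF s \<epsilon>] \<phi>R[OF s]] wG[OF s, of \<epsilon> "z \<epsilon> s"]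
          unfolding h_def d_def \<kappa>_def by linarith
      qed
      also have "\<dots> = c * \<kappa> + LF * integral {0..c} (\<lambda>s. norm (d \<epsilon> s))"
        using integral_unique[OF bi] by simp
      also have "c * \<kappa> \<le> \<kappa> * L" using mult_left_mono[of c L \<kappa>] c \<kappa>0 by (simp add: mult.commute)
      finally show ?thesis using integral_unique[OF hd[OF c]] by simp
    qed
    then have "norm (d \<epsilon> s) \<le> \<kappa> * L * exp (LF * s)"
      by (rule gronwall_integral[OF nc LF(1) _ s])
    also have "\<dots> \<le> \<kappa> * L * exp (LF * L)"
      using s \<kappa>0 L LF by (intro mult_left_mono) (auto intro: mult_left_mono)
    finally show ?thesis by (simp add: \<kappa>_def C_def mult_ac)
  qed
  \<comment> \<open>At \<open>\<epsilon> = 0\<close> the deviation bound is zero.\<close>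
  show z0: "z 0 L = \<phi> L" using dC[OF LL, of 0] by (simp add: d_def)

  obtain c where c0: "0 \<le> c" and cM: "\<And>r s x. r \<in> {0..L} \<Longrightarrow> s \<in> {0..L} \<Longrightarrow> norm (M r s *v x) \<le> c * norm x"
    using bounds by metis
  have McG: "continuous_on {0..L} (\<lambda>s. M L s *v G (x s))" if "continuous_on {0..L} x" for x
    using bounded_bilinear.continuous_on[OF bounded_bilinear_matrix_vector_mult M_continuous[OF LL]]
      continuous_on_compose2[OF C1_torus_field_continuous[OF G] that] by blast
  \<comment> \<open>Subtracting the candidate response from the variation formula leaves the
    linearization error of \<open>F\<close> and the difference of \<open>G\<close> along the two
    trajectories, both of which turn out to be o(\<epsilon>).\<close>
  have dI: "((\<lambda>s. M L s *v (F (z \<epsilon> s) - F (\<phi> s) - A s *v d \<epsilon> s) + (\<epsilon> * w s) *\<^sub>R (M L s *v (G (z \<epsilon> s) - G (\<phi> s))))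
      has_integral d \<epsilon> L - \<epsilon> *\<^sub>R I) {0..L}" for \<epsilon>
  proof -
    \<comment> \<open>The integrand splits into a continuous function and the weight times a
      continuous function.\<close>
    have "(\<lambda>s. M L s *v (F (z \<epsilon> s) - F (\<phi> s)) + \<epsilon> *\<^sub>R (w s *\<^sub>R (M L s *v G (z \<epsilon> s)))) integrable_on {0..L}"
    proof (intro integrable_add integrable_cmul w_int McG zc integrable_continuous_real)
      show "continuous_on {0..L} (\<lambda>s. M L s *v (F (z \<epsilon> s) - F (\<phi> s)))"
        by (intro bounded_bilinear.continuous_on[OF bounded_bilinear_matrix_vector_mult M_continuous[OF LL]]
            continuous_on_diff continuous_on_compose2[OF C1_torus_field_continuous[OF F, of UNIV]] zc \<phi>c) auto
    qed
    then have Mh: "(\<lambda>s. M L s *v h \<epsilon> s) integrable_on {0..L}"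
      by (simp add: h_def matrix_vector_right_distrib matrix_vector_mult_scaleR)
    have "((\<lambda>s. M L s *v (h \<epsilon> s - A s *v d \<epsilon> s)) has_integral d \<epsilon> L) {0..L}"
    proof (rule variation_of_constants[OF hd _ Mh])
      fix s assume s: "s \<in> {0..L}"
      show "norm (h \<epsilon> s) \<le> BF + BF + \<bar>\<epsilon>\<bar> * (W * BG)"
        unfolding h_def using BF(2)[of "z \<epsilon> s"] BF(2)[of "\<phi> s"] wG[OF s, of \<epsilon> "z \<epsilon> s"]
        by (intro norm_triangle_le add_mono norm_triangle_le_diff) auto
    qed
    moreover have "((\<lambda>s. \<epsilon> *\<^sub>R (w s *\<^sub>R (M L s *v G (\<phi> s)))) has_integral \<epsilon> *\<^sub>R I) {0..L}"
      unfolding I_def by (intro has_integral_cmul integrable_integral w_int McG \<phi>c)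
    ultimately have "((\<lambda>s. M L s *v (h \<epsilon> s - A s *v d \<epsilon> s) - \<epsilon> *\<^sub>R (w s *\<^sub>R (M L s *v G (\<phi> s))))
      has_integral d \<epsilon> L - \<epsilon> *\<^sub>R I) {0..L}"
      by (rule has_integral_diff)
    then show ?thesis
      by (rule has_integral_eq[rotated])
        (simp add: h_def matrix_vector_right_distrib matrix_vector_mult_diff_distrib matrix_vector_mult_scaleR
          scaleR_diff_right)
  qed
  show "((\<lambda>\<epsilon>. z \<epsilon> L) has_vector_derivative I) (at 0)"
    unfolding has_vector_derivative_def has_derivative_at_alt
  proof (intro conjI allI impI)
    fix e :: real assume e: "0 < e"
    \<comment> \<open>Two error terms, each pointwise at most
      \<open>\<eta> * c * C * \<bar>\<epsilon>\<bar>\<close>, integrate to at most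
      \<open>2 * \<eta> * (c * C * L) * \<bar>\<epsilon>\<bar>\<close>; this choice keeps that below
      \<open>e * \<bar>\<epsilon>\<bar>\<close>.\<close>
    define \<eta> where "\<eta> = e / (2 * (c * C * L + 1))"
    have cCL: "0 \<le> c * C * L" using c0 C0 L by simp
    have \<eta>: "0 < \<eta>" using e cCL by (simp add: \<eta>_def)
    obtain \<delta> where \<delta>: "0 < \<delta>" "\<And>x y. x \<in> cball 0 R \<Longrightarrow> y \<in> cball 0 R \<Longrightarrow> norm (x - y) < \<delta> \<Longrightarrow>
        norm (F x - F y - jacobian F (at y) *v (x - y)) \<le> \<eta> * norm (x - y)"
      using C1_torus_field_linearization[OF F \<eta>] by metis
    \<comment> \<open>Three demands on \<epsilon>: at most 1 keeps \<open>z \<epsilon>\<close> in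
      the ball, \<open>\<delta> / (C + 1)\<close> makes the deviation small enough to linearize
      \<open>F\<close>, and \<open>\<eta> / (W * LG + 1)\<close> absorbs the \<open>G\<close> term,
      which is quadratic in \<epsilon>, into the same bound as the \<open>F\<close> term.\<close>
    define \<rho> where "\<rho> = min 1 (min (\<delta> / (C + 1)) (\<eta> / (W * LG + 1)))"
    have WLG: "0 \<le> W * LG" using W0 LG by simp
    have \<rho>: "0 < \<rho>" using \<delta> \<eta> C0 WLG by (simp add: \<rho>_def)
    have "norm (z \<epsilon> L - z 0 L - (\<epsilon> - 0) *\<^sub>R I) \<le> e * norm (\<epsilon> - 0)" if "norm (\<epsilon> - 0) < \<rho>" for \<epsilon>
    proof -
      have \<epsilon>1: "\<bar>\<epsilon>\<bar> \<le> 1" and \<epsilon>2: "\<bar>\<epsilon>\<bar> < \<delta> / (C + 1)" and \<epsilon>3: "\<bar>\<epsilon>\<bar> < \<eta> / (W * LG + 1)"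
        using that by (auto simp: \<rho>_def)
      have "\<bar>\<epsilon>\<bar> * C \<le> \<bar>\<epsilon>\<bar> * (C + 1)" by (intro mult_left_mono) auto
      also have "\<dots> < \<delta>" using \<epsilon>2 C0 by (simp add: pos_less_divide_eq)
      finally have small: "\<bar>\<epsilon>\<bar> * C < \<delta>" .
      have "\<bar>\<epsilon>\<bar> * (W * LG) \<le> \<bar>\<epsilon>\<bar> * (W * LG + 1)" by (intro mult_left_mono) auto
      also have "\<dots> \<le> \<eta>" using \<epsilon>3 WLG by (simp add: pos_less_divide_eq)
      finally have smallG: "\<bar>\<epsilon>\<bar> * (W * LG) \<le> \<eta>" .
      define B where "B = 2 * \<eta> * c * C * \<bar>\<epsilon>\<bar>"
      have "norm (d \<epsilon> L - \<epsilon> *\<^sub>R I) \<le> B * (L - 0)"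
      proof -
        have "norm (M L s *v (F (z \<epsilon> s) - F (\<phi> s) - A s *v d \<epsilon> s) + (\<epsilon> * w s) *\<^sub>R (M L s *v (G (z \<epsilon> s) - G (\<phi> s)))) \<le> B"
          if s: "s \<in> {0..L}" for s
        proof -
          have "norm (F (z \<epsilon> s) - F (\<phi> s) - A s *v d \<epsilon> s) \<le> \<eta> * norm (d \<epsilon> s)"
            using \<delta>(2)[OF zR[OF s \<epsilon>1] \<phi>R[OF s]] dC[OF s \<epsilon>1] small by (simp add: d_def A_def)
          also have "\<dots> \<le> \<eta> * (\<bar>\<epsilon>\<bar> * C)" using dC[OF s \<epsilon>1] \<eta> by (intro mult_left_mono) auto
          finally have 1: "norm (M L s *v (F (z \<epsilon> s) - F (\<phi> s) - A s *v d \<epsilon> s)) \<le> c * (\<eta> * (\<bar>\<epsilon>\<bar> * C))"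
            using cM[OF LL s] c0 by (meson mult_left_mono order_trans)
          have "norm (G (z \<epsilon> s) - G (\<phi> s)) \<le> LG * norm (d \<epsilon> s)"
            using LG(2)[OF zR[OF s \<epsilon>1] \<phi>R[OF s]] by (simp add: d_def)
          also have "\<dots> \<le> LG * (\<bar>\<epsilon>\<bar> * C)" using dC[OF s \<epsilon>1] LG by (intro mult_left_mono) auto
          finally have "norm (M L s *v (G (z \<epsilon> s) - G (\<phi> s))) \<le> c * (LG * (\<bar>\<epsilon>\<bar> * C))"
            using cM[OF LL s] c0 by (meson mult_left_mono order_trans)
          then have "norm ((\<epsilon> * w s) *\<^sub>R (M L s *v (G (z \<epsilon> s) - G (\<phi> s)))) \<le> (\<bar>\<epsilon>\<bar> * W) * (c * (LG * (\<bar>\<epsilon>\<bar> * C)))"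
            unfolding norm_scaleR abs_mult using w[OF s] W0 by (intro mult_mono) auto
          also have "\<dots> = (\<bar>\<epsilon>\<bar> * (W * LG)) * (c * (\<bar>\<epsilon>\<bar> * C))" by (simp add: mult_ac)
          also have "\<dots> \<le> \<eta> * (c * (\<bar>\<epsilon>\<bar> * C))" using smallG c0 C0 by (intro mult_right_mono) auto
          finally have 2: "norm ((\<epsilon> * w s) *\<^sub>R (M L s *v (G (z \<epsilon> s) - G (\<phi> s)))) \<le> \<eta> * (c * (\<bar>\<epsilon>\<bar> * C))" .
          have "c * (\<eta> * (\<bar>\<epsilon>\<bar> * C)) + \<eta> * (c * (\<bar>\<epsilon>\<bar> * C)) = B" by (simp add: B_def mult_ac)
          then show ?thesis using norm_triangle_le[OF add_mono[OF 1 2]] by simp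
        qed
        moreover have "0 \<le> B" using \<eta> c0 C0 by (simp add: B_def)
        ultimately show ?thesis
          using has_integral_bound_real[OF _ _ dI[of \<epsilon>], of B "{}"] L by auto
      qed
      also have "B * (L - 0) = (2 * \<eta> * (c * C * L)) * \<bar>\<epsilon>\<bar>" by (simp add: B_def mult_ac)
      also have "\<dots> \<le> e * \<bar>\<epsilon>\<bar>"
      proof (rule mult_right_mono)
        have "2 * \<eta> * (c * C * L) = e * ((c * C * L) / (c * C * L + 1))"
          using cCL by (simp add: \<eta>_def field_simps)
        also have "\<dots> \<le> e * 1" using e cCL by (intro mult_left_mono) auto
        finally show "2 * \<eta> * (c * C * L) \<le> e" by simp
      qed simp
      finally show ?thesis by (simp add: z0 d_def algebra_simps)
    qed
    then show "\<exists>\<rho>>0. \<forall>\<epsilon>. norm (\<epsilon> - 0) < \<rho> \<longrightarrow> norm (z \<epsilon> L - z 0 L - (\<epsilon> - 0) *\<^sub>R I) \<le> e * norm (\<epsilon> - 0)"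
      using \<rho> by blast
  qed (rule bounded_linear_scaleR_left)
qed

text \<open>The filter \<open>at 0\<close> omits the point itself, so the Landau bound says nothing
  about \<open>f 0\<close>; its value is a separate hypothesis.\<close>

lemma bigo_square_imp_has_vector_derivative:
  fixes f :: "real \<Rightarrow> 'a::real_normed_vector"
  assumes O: "(\<lambda>\<epsilon>. norm (f \<epsilon> - (a + \<epsilon> *\<^sub>R v))) \<in> O[at 0](\<lambda>\<epsilon>. \<epsilon>\<^sup>2)" and f0: "f 0 = a"
  shows "(f has_vector_derivative v) (at 0)"
proof -
  obtain c where c: "0 < c" "\<forall>\<^sub>F \<epsilon> in at 0. norm (norm (f \<epsilon> - (a + \<epsilon> *\<^sub>R v))) \<le> c * norm (\<epsilon>\<^sup>2 :: real)"
    using O by (rule landau_o.bigE)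
  show ?thesis
    unfolding has_vector_derivative_def has_derivative_within_alt2
  proof (intro conjI allI impI)
    fix e :: real assume e: "0 < e"
    have "\<forall>\<^sub>F \<epsilon> in at (0::real). \<bar>\<epsilon>\<bar> < e / c"
      using e c(1) by (auto simp: eventually_at dist_real_def intro!: exI[of _ "e / c"])
    with c(2) show "\<forall>\<^sub>F \<epsilon> in at 0. norm (f \<epsilon> - f 0 - (\<epsilon> - 0) *\<^sub>R v) \<le> e * norm (\<epsilon> - 0)"
    proof eventually_elim
      case (elim \<epsilon>)
      have "norm (f \<epsilon> - f 0 - (\<epsilon> - 0) *\<^sub>R v) \<le> (c * \<bar>\<epsilon>\<bar>) * \<bar>\<epsilon>\<bar>"
        using elim(1) by (simp add: f0 algebra_simps power2_eq_square abs_mult)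
      also have "\<dots> \<le> e * \<bar>\<epsilon>\<bar>"
        using elim(2) c(1) by (intro mult_right_mono) (auto simp: pos_less_divide_eq mult.commute)
      finally show ?case by simp
    qed
  qed (rule bounded_linear_scaleR_left)
qed

theorem theorem2:
  fixes F G :: "real^'n \<Rightarrow> real^'n"
    and T K\<^sub>m\<^sub>i\<^sub>n :: real
    and K S t w :: "real \<Rightarrow> real"
    and \<theta>\<^sub>0 :: "real^'n"
    and \<theta> :: "real \<Rightarrow> real \<Rightarrow> real^'n"
    and \<phi> :: "real \<Rightarrow> real^'n"
    and M :: "real \<Rightarrow> real \<Rightarrow> real^'n^'n"
  assumes F: "C1_torus_field F"
    and G: "C1_torus_field G"
    and T: "T > 0"
    and K_int: "K absolutely_integrable_on {0..T}"
    and K_min: "K\<^sub>m\<^sub>i\<^sub>n > 0" "\<And>u. u \<in> {0..T} \<Longrightarrow> K u \<ge> K\<^sub>m\<^sub>i\<^sub>n"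
    and S: "S = (\<lambda>r. integral {0..r} K)"
    and t: "t = the_inv_into {0..T} S"
    and w: "w = (\<lambda>s. 1 / K (t s))"
    and \<phi>: "ode_solution (\<lambda>s x. F x) 0 (S T) \<phi>" "\<phi> 0 = \<theta>\<^sub>0"
    and \<theta>: "\<And>\<epsilon>. ode_solution (\<lambda>r x. K r *\<^sub>R F x + \<epsilon> *\<^sub>R G x) 0 T (\<theta> \<epsilon>)"
           "\<And>\<epsilon>. \<theta> \<epsilon> 0 = \<theta>\<^sub>0"
    and M: "fundamental_matrix (\<lambda>s. jacobian F (at (\<phi> s))) 0 (S T) M"
  shows "(\<lambda>s. w s *\<^sub>R (M (S T) s *v G (\<phi> s))) integrable_on {0..S T} \<and>
         (\<forall>\<psi> :: real \<Rightarrow> real^'n.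
            (\<forall>s\<in>{0..S T}.
               (\<lambda>\<epsilon>. norm (\<theta> \<epsilon> (t s) - (\<phi> s + \<epsilon> *\<^sub>R \<psi> s))) \<in> O[at 0](\<lambda>\<epsilon>. \<epsilon>\<^sup>2)) \<longrightarrow>
            \<psi> (S T) = integral {0..S T} (\<lambda>s. w s *\<^sub>R (M (S T) s *v G (\<phi> s)))) \<and>
         ((\<lambda>\<epsilon>. \<theta> \<epsilon> (t (S T))) has_vector_derivative
            integral {0..S T} (\<lambda>s. w s *\<^sub>R (M (S T) s *v G (\<phi> s)))) (at 0) \<and>
         (w has_integral T) {0..S T}"
proof -
  interpret tc: time_change K T "K\<^sub>m\<^sub>i\<^sub>n"
    using T K_min K_int by unfold_locales (auto intro: set_lebesgue_integral_eq_integral(1))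
  have S_eq: "S = tc.S" unfolding S tc.S_def[abs_def] by simp
  have t_eq: "t = tc.t" unfolding t tc.t_def S_eq by simp
  define L where "L = S T"
  have T_in: "T \<in> {0..T}" and "0 \<in> {0..T}" using T by auto
  then have L0: "0 \<le> L" and L_in: "L \<in> {0..L}" using tc.S_in[of 0] unfolding L_def S_eq by auto
  have K_t: "K\<^sub>m\<^sub>i\<^sub>n \<le> K (t s)" if "s \<in> {0..L}" for s
    using K_min(2) tc.t_in that unfolding L_def S_eq t_eq by blast
  have w_int: "(\<lambda>s. w s *\<^sub>R g s) integrable_on {0..L}" if "continuous_on {0..L} g" for g :: "real \<Rightarrow> real^'n"
    using tc.weight_continuous_has_integral[OF T_in, of g] that
    unfolding L_def S_eq t_eq w by (auto intro: has_integral_integrable)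
  have w_bound: "\<bar>w s\<bar> \<le> 1 / K\<^sub>m\<^sub>i\<^sub>n" if "s \<in> {0..L}" for s
    using K_t[OF that] K_min(1) by (simp add: w frac_le)
  have \<phi>_int: "((\<lambda>s. F (\<phi> s)) has_integral \<phi> c - \<theta>\<^sub>0) {0..c}" if "c \<in> {0..L}" for c
    using ode_solution_has_integral[OF \<phi>(1)] that \<phi>(2) unfolding L_def by simp
  obtain BF where BF: "0 \<le> BF" "\<And>x. norm (F x) \<le> BF" using C1_torus_field_bounded[OF F] by metis
  obtain BG where BG: "0 \<le> BG" "\<And>x. norm (G x) \<le> BG" using C1_torus_field_bounded[OF G] by metis
  have \<theta>_int: "((\<lambda>s. F (\<theta> \<epsilon> (t s)) + (\<epsilon> * w s) *\<^sub>R G (\<theta> \<epsilon> (t s))) has_integral \<theta> \<epsilon> (t c) - \<theta>\<^sub>0) {0..c}"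
    if c: "c \<in> {0..L}" for \<epsilon> c
  proof -
    have tc: "t c \<in> {0..T}" "S (t c) = c" using c tc.t_in tc.S_t unfolding L_def S_eq t_eq by auto
    define f where "f r = K r *\<^sub>R F (\<theta> \<epsilon> r) + \<epsilon> *\<^sub>R G (\<theta> \<epsilon> r)" for r
    have "((\<lambda>s. (1 / K (t s)) *\<^sub>R f (t s)) has_integral \<theta> \<epsilon> (t c) - \<theta>\<^sub>0) {0..S (t c)}"
      unfolding S_eq t_eq
    proof (rule tc.has_integral_time_change)
      show "tc.t c \<in> {0..T}" using tc(1) by (simp add: t_eq)
      show "(f has_integral \<theta> \<epsilon> (tc.t c) - \<theta>\<^sub>0) {0..tc.t c}"
        using ode_solution_has_integral[OF \<theta>(1) tc(1), of \<epsilon>] \<theta>(2) by (simp add: f_def[abs_def] t_eq)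
      fix u assume "u \<in> {0..tc.t c}"
      then have Ku: "K\<^sub>m\<^sub>i\<^sub>n \<le> K u" using K_min(2)[of u] tc(1) by (simp add: t_eq)
      have "norm (f u) \<le> K u * BF + \<bar>\<epsilon>\<bar> * BG"
        unfolding f_def using BF(2) BG(2) Ku K_min(1)
        by (intro norm_triangle_le add_mono) (auto intro!: mult_left_mono)
      \<comment> \<open>The \<open>F\<close> term already carries the factor \<open>K u\<close>; the
        bounded \<open>G\<close> term becomes a multiple of it because
        \<open>K u / K\<^sub>m\<^sub>i\<^sub>n \<ge> 1\<close>.\<close>
      also have "\<bar>\<epsilon>\<bar> * BG \<le> \<bar>\<epsilon>\<bar> * BG / K\<^sub>m\<^sub>i\<^sub>n * K u"
      proof -
        have "\<bar>\<epsilon>\<bar> * BG / K\<^sub>m\<^sub>i\<^sub>n * K\<^sub>m\<^sub>i\<^sub>n \<le> \<bar>\<epsilon>\<bar> * BG / K\<^sub>m\<^sub>i\<^sub>n * K u"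
          using Ku BG K_min(1) by (intro mult_left_mono) auto
        then show ?thesis using K_min(1) by simp
      qed
      finally show "norm (f u) \<le> (BF + \<bar>\<epsilon>\<bar> * BG / K\<^sub>m\<^sub>i\<^sub>n) * K u" by (simp add: algebra_simps)
    qed
    then show ?thesis
      unfolding tc(2)
    proof (rule has_integral_eq[rotated])
      fix s assume "s \<in> {0..c}"
      then have "K (t s) \<noteq> 0" using K_t[of s] c K_min(1) by auto
      then show "(1 / K (t s)) *\<^sub>R f (t s) = F (\<theta> \<epsilon> (t s)) + (\<epsilon> * w s) *\<^sub>R G (\<theta> \<epsilon> (t s))"
        by (simp add: f_def w scaleR_add_right)
    qed
  qed
  note response = perturbation_has_vector_derivative[where z = "\<lambda>\<epsilon> s. \<theta> \<epsilon> (t s)",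
      OF F G L0 w_bound w_int \<phi>_int \<theta>_int M[folded L_def]]
  have \<phi>_cont: "continuous_on {0..L} \<phi>"
  proof -
    have "continuous_on {0..L} (\<lambda>c. \<theta>\<^sub>0 + integral {0..c} (\<lambda>s. F (\<phi> s)))"
      using \<phi>_int[OF L_in] by (intro continuous_intros indefinite_integral_continuous_1) (rule has_integral_integrable)
    then show ?thesis
      by (rule continuous_on_eq) (use integral_unique[OF \<phi>_int] in simp)
  qed
  interpret fundamental "\<lambda>s. jacobian F (at (\<phi> s))" L M
    using F L0 M \<phi>_cont continuous_on_compose2[of UNIV "\<lambda>x. jacobian F (at x)" "{0..L}" \<phi>]
    by unfold_locales (auto simp: C1_torus_field_def L_def)
  \<comment> \<open>Continuity of \<open>M L\<close> in its second argument makes the cofactor of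
    \<open>w\<close> continuous, so the integral in the formula exists.\<close>
  have integrable: "(\<lambda>s. w s *\<^sub>R (M L s *v G (\<phi> s))) integrable_on {0..L}"
    by (intro w_int bounded_bilinear.continuous_on[OF bounded_bilinear_matrix_vector_mult M_continuous[OF L_in]]
        continuous_on_compose2[OF C1_torus_field_continuous[OF G, of UNIV] \<phi>_cont]) auto
  have "\<psi> L = integral {0..L} (\<lambda>s. w s *\<^sub>R (M L s *v G (\<phi> s)))"
    if "\<forall>s\<in>{0..L}. (\<lambda>\<epsilon>. norm (\<theta> \<epsilon> (t s) - (\<phi> s + \<epsilon> *\<^sub>R \<psi> s))) \<in> O[at 0](\<lambda>\<epsilon>. \<epsilon>\<^sup>2)" for \<psi> :: "real \<Rightarrow> real^'n"
    \<comment> \<open>\<open>response(2)\<close> supplies the value at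
      \<open>\<epsilon> = 0\<close>; the derivative from the expansion and the one from the response
      formula must then agree.\<close>
    using bigo_square_imp_has_vector_derivative[OF bspec[OF that L_in] response(2)] response(1)
    by (rule vector_derivative_unique_at)
  moreover have "(w has_integral T) {0..L}"
    using tc.weight_has_integral unfolding w L_def S_eq t_eq .
  ultimately show ?thesis
    using integrable response(1) unfolding L_def by blast
qed

end
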